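(* Let $W$ be an infinite small Coxeter group which is virtually abelian. Then $W$ admits the congruence subgroup property with respect to the Tits representation of its corresponding small Coxeter system.
   Context: A Coxeter system $(W,S)$ of finite rank $n$ consists of a group $W$ with generators $S=\{w_1,\dots,w_n\}$ and presentation $W=\langle w_1,\dots,w_n \mid (w_iw_j)^{m_{i,j}}=1 \text{ whenever } m_{i,j}<\infty\rangle$, where $m_{i,j}=m_{j,i}\in\mathbb{N}\cup\{\infty\}$ and $m_{i,j}=1$ if and only if $i=j$. The Coxeter system is small if every $m_{i,j}$ lies in $\{1,2,3,\infty\}$; a small Coxeter group is a group $W$ admitting (and here equipped with) a small Coxeter system. All Coxeter systems have finite rank. Let $V$ be the real vector space with basis $e_1,\dots,e_n$ and symmetric bilinear form $B(e_i,e_j)=-\cos(\pi/m_{i,j})$ if $m_{i,j}\neq\infty$, and $B(e_i,e_j)=-1$ if $m_{i,j}=\infty$. The Tits representation $\rho:W\to \mathrm{GL}(V)$ is given by $\rho(w_i)(v)=v-2B(e_i,v)e_i$. For a small Coxeter system, the matrices of $\rho$ in the basis $e_1,\dots,e_n$ are integral, so $\rho:W\to \mathrm{GL}(n,\mathbb{Z})$. For $m\ge 2$ the principal congruence subgroup $W[m]$ is the kernel of $W\xrightarrow{\rho}\mathrm{GL}(n,\mathbb{Z})\to\mathrm{GL}(n,\mathbb{Z}/m)$. $W$ admits the congruence subgroup property with respect to $\rho$ if every finite index subgroup of $W$ contains $W[m]$ for some $m\ge 2$. A group is virtually abelian if it has an abelian subgroup of finite index. *)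

theory Defs
  imports
    "HOL-Algebra.Coset"
    "HOL-Library.Extended_Nat"
    "HOL-Library.FuncSet"
    "Jordan_Normal_Form.Matrix"
begin

section \<open>Group presentations\<close>

text \<open>A word is a list of signed letters; \<open>(i, True)\<close> is the generator \<open>i\<close> and
  \<open>(i, False)\<close> its formal inverse. The group presented by generators \<open>I\<close> and relators \<open>R\<close>
  is the set of words over \<open>I\<close> modulo the congruence \<open>pres_cong I R\<close>.\<close>

type_synonym 'i word = "('i \<times> bool) list"

abbreviation words :: "'i set \<Rightarrow> 'i word set" where
  "words I \<equiv> lists (I \<times> UNIV)"

inductive pres_cong :: "'i set \<Rightarrow> 'i word set \<Rightarrow> 'i word \<Rightarrow> 'i word \<Rightarrow> bool"
  for I :: "'i set" and R :: "'i word set" where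
  refl: "u \<in> words I \<Longrightarrow> pres_cong I R u u"
| sym: "pres_cong I R u v \<Longrightarrow> pres_cong I R v u"
| trans: "pres_cong I R u v \<Longrightarrow> pres_cong I R v x \<Longrightarrow> pres_cong I R u x"
| append: "pres_cong I R u u' \<Longrightarrow> pres_cong I R v v' \<Longrightarrow> pres_cong I R (u @ v) (u' @ v')"
| cancel: "i \<in> I \<Longrightarrow> pres_cong I R [(i, b), (i, \<not> b)] []"
| relator: "r \<in> R \<Longrightarrow> pres_cong I R r []"

primrec word_val :: "('a, 'b) monoid_scheme \<Rightarrow> ('i \<Rightarrow> 'a) \<Rightarrow> 'i word \<Rightarrow> 'a" where
  "word_val G w [] = \<one>\<^bsub>G\<^esub>"
| "word_val G w (x # xs) =
     (if snd x then w (fst x) else inv\<^bsub>G\<^esub> (w (fst x))) \<otimes>\<^bsub>G\<^esub> word_val G w xs"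

text \<open>\<open>G\<close> is presented by \<open>R\<close> on the generators \<open>w i\<close>, \<open>i \<in> I\<close>: evaluation of words induces
  an isomorphism from words modulo \<open>pres_cong I R\<close> onto \<open>G\<close>.\<close>

definition has_presentation ::
    "('a, 'b) monoid_scheme \<Rightarrow> 'i set \<Rightarrow> ('i \<Rightarrow> 'a) \<Rightarrow> 'i word set \<Rightarrow> bool" where
  "has_presentation G I w R \<longleftrightarrow>
     group G \<and> R \<subseteq> words I \<and> w \<in> I \<rightarrow> carrier G \<and>
     word_val G w ` words I = carrier G \<and>
     (\<forall>u\<in>words I. \<forall>v\<in>words I. word_val G w u = word_val G w v \<longleftrightarrow> pres_cong I R u v)"

section \<open>Coxeter systems\<close>

text \<open>The generators are indexed by \<open>0, \<dots>, n - 1\<close>; values of \<open>m\<close> and \<open>w\<close> outside this range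
  are irrelevant.\<close>

definition coxeter_matrix :: "nat \<Rightarrow> (nat \<Rightarrow> nat \<Rightarrow> enat) \<Rightarrow> bool" where
  "coxeter_matrix n m \<longleftrightarrow>
     (\<forall>i<n. \<forall>j<n. m i j = m j i \<and> m i j \<ge> 1 \<and> (m i j = 1 \<longleftrightarrow> i = j))"

definition coxeter_relators :: "nat \<Rightarrow> (nat \<Rightarrow> nat \<Rightarrow> enat) \<Rightarrow> nat word set" where
  "coxeter_relators n m =
     {concat (replicate k [(i, True), (j, True)]) | i j k. i < n \<and> j < n \<and> m i j = enat k}"

definition coxeter_system ::
    "('a, 'b) monoid_scheme \<Rightarrow> nat \<Rightarrow> (nat \<Rightarrow> nat \<Rightarrow> enat) \<Rightarrow> (nat \<Rightarrow> 'a) \<Rightarrow> bool" where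
  "coxeter_system W n m w \<longleftrightarrow>
     coxeter_matrix n m \<and> has_presentation W {..<n} w (coxeter_relators n m)"

definition small_coxeter_system ::
    "('a, 'b) monoid_scheme \<Rightarrow> nat \<Rightarrow> (nat \<Rightarrow> nat \<Rightarrow> enat) \<Rightarrow> (nat \<Rightarrow> 'a) \<Rightarrow> bool" where
  "small_coxeter_system W n m w \<longleftrightarrow>
     coxeter_system W n m w \<and> (\<forall>i<n. \<forall>j<n. m i j \<in> {1, 2, 3, \<infinity>})"

section \<open>The Tits representation\<close>

text \<open>\<open>V\<close> is \<open>carrier_vec n\<close> over the reals with \<open>e\<^sub>i = unit_vec n i\<close>, and linear maps are
  identified with their matrices in this basis.\<close>

definition coxeter_gram :: "nat \<Rightarrow> (nat \<Rightarrow> nat \<Rightarrow> enat) \<Rightarrow> real mat" where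
  "coxeter_gram n m =
     mat n n (\<lambda>(i, j). case m i j of enat k \<Rightarrow> - cos (pi / real k) | \<infinity> \<Rightarrow> - 1)"

definition coxeter_form ::
    "nat \<Rightarrow> (nat \<Rightarrow> nat \<Rightarrow> enat) \<Rightarrow> real vec \<Rightarrow> real vec \<Rightarrow> real" where
  "coxeter_form n m u v = u \<bullet> (coxeter_gram n m *\<^sub>v v)"

definition GL :: "nat \<Rightarrow> real mat monoid" where
  "GL n = units_of (ring_mat TYPE(real) n ())"

text \<open>The homomorphism is unique because the \<open>w i\<close> generate \<open>W\<close>; \<open>extensional\<close> fixes its
  irrelevant values outside \<open>carrier W\<close>.\<close>

definition tits_rep ::
    "('a, 'b) monoid_scheme \<Rightarrow> nat \<Rightarrow> (nat \<Rightarrow> nat \<Rightarrow> enat) \<Rightarrow> (nat \<Rightarrow> 'a) \<Rightarrow> 'a \<Rightarrow> real mat" where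
  "tits_rep W n m w =
     (THE \<rho>. \<rho> \<in> hom W (GL n) \<and> \<rho> \<in> extensional (carrier W) \<and>
        (\<forall>i<n. \<forall>v\<in>carrier_vec n.
           \<rho> (w i) *\<^sub>v v
             = v - (2 * coxeter_form n m (unit_vec n i) v) \<cdot>\<^sub>v unit_vec n i))"

section \<open>Congruence subgroups\<close>

text \<open>For a small system every \<open>tits_rep W n m w g\<close> is the image of a unique integral matrix
  \<open>A\<close>; the last condition says that \<open>A\<close> and the identity have the same reduction modulo \<open>q\<close>.\<close>

definition principal_congruence_subgroup ::
    "('a, 'b) monoid_scheme \<Rightarrow> nat \<Rightarrow> (nat \<Rightarrow> nat \<Rightarrow> enat) \<Rightarrow> (nat \<Rightarrow> 'a) \<Rightarrow> nat \<Rightarrow> 'a set" where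
  "principal_congruence_subgroup W n m w q =
     {g \<in> carrier W. \<exists>A \<in> carrier_mat n n.
        tits_rep W n m w g = map_mat real_of_int A \<and>
        map_mat (\<lambda>a. a mod int q) A = map_mat (\<lambda>a. a mod int q) (1\<^sub>m n)}"

definition finite_index_subgroup :: "'a set \<Rightarrow> ('a, 'b) monoid_scheme \<Rightarrow> bool" where
  "finite_index_subgroup H G \<longleftrightarrow> subgroup H G \<and> finite (rcosets\<^bsub>G\<^esub> H)"

definition has_congruence_subgroup_property ::
    "('a, 'b) monoid_scheme \<Rightarrow> nat \<Rightarrow> (nat \<Rightarrow> nat \<Rightarrow> enat) \<Rightarrow> (nat \<Rightarrow> 'a) \<Rightarrow> bool" where
  "has_congruence_subgroup_property W n m w \<longleftrightarrow>
     (\<forall>H. finite_index_subgroup H W \<longrightarrow>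
        (\<exists>q\<ge>2. principal_congruence_subgroup W n m w q \<subseteq> H))"

definition virtually_abelian :: "('a, 'b) monoid_scheme \<Rightarrow> bool" where
  "virtually_abelian G \<longleftrightarrow>
     (\<exists>A. finite_index_subgroup A G \<and> comm_group (G\<lparr>carrier := A\<rparr>))"

end

theory Submission
  imports Defs
begin

text \<open>Let \<open>R\<close> be the radical of the form. If two roots satisfied \<open>|B(a, b)| > 1\<close>, a power of the
  product of their reflections would be hyperbolic on the plane spanned by \<open>a\<close> and \<open>b\<close>, and
  commuting with its conjugates (up to powers, as \<open>W\<close> is virtually abelian) would force every simple
  root to lie in this plane or to be orthogonal to it, which is impossible. Hence \<open>B\<close> takes only
  finitely many values on pairs of roots, the image of \<open>W\<close> in \<open>GL(V/R)\<close> is finite, and on the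
  kernel \<open>K\<close> of finite index the map \<open>g \<mapsto> \<rho>(g) - 1\<close> is additive, because \<open>W\<close> fixes \<open>R\<close>
  pointwise. A subgroup \<open>H\<close> of finite index thus meets \<open>K\<close> in a group whose image under \<open>\<rho> - 1\<close> is a
  subgroup of the integral matrices, hence closed in the congruence topology. As \<open>\<rho>\<close> is faithful,
  each of the finitely many cosets of \<open>H \<inter> K\<close> outside \<open>H\<close> avoids some congruence subgroup.\<close>

section \<open>Separability of subgroups of free abelian groups\<close>

lemma int_multiple_closed:
  fixes L :: "('i \<Rightarrow> int) set"
  assumes zero: "(\<lambda>_. 0) \<in> L"
    and diff: "\<And>u v. u \<in> L \<Longrightarrow> v \<in> L \<Longrightarrow> (\<lambda>i. u i - v i) \<in> L"
    and u: "u \<in> L"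
  shows "(\<lambda>i. k * u i) \<in> L"
proof (induction k rule: int_induct[where k = 0])
  case base
  then show ?case using zero by simp
next
  case (step1 k)
  have "(\<lambda>i. 0 - u i) \<in> L"
    using diff[OF zero u] .
  from diff[OF step1(2) this] show ?case
    by (simp add: algebra_simps)
next
  case (step2 k)
  from diff[OF step2(2) u] show ?case
    by (simp add: algebra_simps)
qed

text \<open>The least positive element works, by division with remainder; the trivial subgroup gives
  \<open>c = 0\<close>.\<close>

lemma int_subgroup_generator:
  fixes C :: "int set"
  assumes zero: "0 \<in> C" and diff: "\<And>a b. a \<in> C \<Longrightarrow> b \<in> C \<Longrightarrow> a - b \<in> C"
  obtains c where "c \<in> C" "c \<ge> 0" "\<And>a. a \<in> C \<Longrightarrow> c dvd a"
proof (cases "C = {0}")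
  case True
  then show thesis using that[of 0] by auto
next
  case False
  then obtain b where b: "b \<in> C" "b \<noteq> 0"
    using zero by blast
  have neg: "- a \<in> C" if "a \<in> C" for a
    using diff[OF zero that] by simp
  have ex: "\<exists>k::nat. k > 0 \<and> int k \<in> C"
    using b neg[OF b(1)] by (intro exI[of _ "nat \<bar>b\<bar>"]) (auto simp: abs_if)
  define c where "c = (LEAST k::nat. k > 0 \<and> int k \<in> C)"
  have c: "c > 0" "int c \<in> C"
    using LeastI_ex[OF ex] unfolding c_def by auto
  have minimal: "c \<le> k" if "k > 0" "int k \<in> C" for k
    unfolding c_def using that by (intro Least_le) auto
  have mult: "k * int c \<in> C" for k
  proof (induction k rule: int_induct[where k = 0])
    case base
    then show ?case using zero by simp
  next
    case (step1 k)
    then show ?case using diff[OF step1(2) neg[OF c(2)]] by (simp add: algebra_simps)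
  next
    case (step2 k)
    then show ?case using diff[OF step2(2) c(2)] by (simp add: algebra_simps)
  qed
  have "int c dvd a" if a: "a \<in> C" for a
  proof -
    have "a mod int c \<in> C"
      using diff[OF a mult[of "a div int c"]] by (simp add: minus_div_mult_eq_mod)
    moreover have "0 \<le> a mod int c" "a mod int c < int c"
      using c(1) by auto
    ultimately have "a mod int c = 0"
      using minimal[of "nat (a mod int c)"] by (cases "a mod int c = 0") auto
    then show ?thesis by (simp add: dvd_eq_mod_eq_0)
  qed
  then show thesis using that[of "int c"] c by auto
qed

text \<open>Induction on the coordinates: choose \<open>g\<close> in \<open>L\<close> whose
  \<open>a\<close>-coordinate generates the projection of \<open>L\<close>. Subtracting multiples of
  \<open>g\<close> reduces the claim to the subgroup of \<open>L\<close> vanishing at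
  \<open>a\<close>. In other words, subgroups are closed in the congruence topology.\<close>

lemma int_subgroup_separable:
  fixes L :: "('i \<Rightarrow> int) set" and x :: "'i \<Rightarrow> int"
  assumes "finite I"
    and "(\<lambda>_. 0) \<in> L"
    and "\<And>u v. u \<in> L \<Longrightarrow> v \<in> L \<Longrightarrow> (\<lambda>i. u i - v i) \<in> L"
    and "\<And>q. q \<ge> 2 \<Longrightarrow> \<exists>l\<in>L. \<forall>i\<in>I. int q dvd x i - l i"
  shows "\<exists>l\<in>L. \<forall>i\<in>I. x i = l i"
  using assms
proof (induction I arbitrary: L x rule: finite_induct)
  case empty
  then show ?case by blast
next
  case (insert a I)
  note zero = insert.prems(1) and diff = insert.prems(2) and approx = insert.prems(3)
  have "\<exists>c\<in>(\<lambda>l. l a) ` L. c \<ge> 0 \<and> (\<forall>b\<in>(\<lambda>l. l a) ` L. c dvd b)"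
  proof -
    have z: "0 \<in> (\<lambda>l. l a) ` L" using zero by force
    have d: "s - t \<in> (\<lambda>l. l a) ` L" if "s \<in> (\<lambda>l. l a) ` L" "t \<in> (\<lambda>l. l a) ` L" for s t
      using that diff by (auto simp: image_iff)
    obtain c where "c \<in> (\<lambda>l. l a) ` L" "c \<ge> 0" "\<And>b. b \<in> (\<lambda>l. l a) ` L \<Longrightarrow> c dvd b"
      using int_subgroup_generator[OF z d] by metis
    then show ?thesis by blast
  qed
  then obtain g where g: "g \<in> L" "g a \<ge> 0" "\<And>l. l \<in> L \<Longrightarrow> g a dvd l a"
    by auto
  show ?case
  proof (cases "g a = 0")
    case True
    then have la: "l a = 0" if "l \<in> L" for l
      using g(3)[OF that] by simp
    have "x a = 0"
    proof (rule ccontr)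
      assume nz: "x a \<noteq> 0"
      \<comment> \<open>A modulus larger than \<open>\<bar>x a\<bar>\<close> forces
        \<open>x a = 0\<close>; as \<open>x a\<close> is nonzero, the modulus is also at least
        2.\<close>
      have "2 \<le> nat (\<bar>x a\<bar> + 1)" using nz by linarith
      then obtain l where "l \<in> L" "int (nat (\<bar>x a\<bar> + 1)) dvd x a - l a"
        using approx by blast
      then have "\<bar>x a\<bar> + 1 dvd x a" using la[of l] by simp
      then show False using dvd_imp_le_int[OF nz, of "\<bar>x a\<bar> + 1"] by simp
    qed
    moreover have "\<exists>l\<in>L. \<forall>i\<in>I. x i = l i"
    proof (rule insert.IH[OF zero])
      show "\<And>u v. u \<in> L \<Longrightarrow> v \<in> L \<Longrightarrow> (\<lambda>i. u i - v i) \<in> L" by (rule diff)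
      show "\<exists>l\<in>L. \<forall>i\<in>I. int q dvd x i - l i" if "q \<ge> 2" for q
        using approx[OF that] by auto
    qed
    ultimately show ?thesis using la by auto
  next
    case False
    then have pos: "g a > 0" using g(2) by simp
    define c where "c = nat (g a)"
    have c: "c > 0" "int c = g a" using pos by (auto simp: c_def)
    define L' where "L' = {l \<in> L. l a = 0}"
    define x' where "x' = (\<lambda>i. x i - (x a div g a) * g i)"
    have xa: "g a dvd x a"
    proof -
      \<comment> \<open>The modulus is \<open>2 * c\<close> because \<open>c\<close> may be 1, while
        moduli start at 2.\<close>
      obtain l where "l \<in> L" "int (2 * c) dvd x a - l a"
        using approx[of "2 * c"] c(1) by (metis One_nat_def Suc_leI insertI1 mult_2 add_mono one_add_one)
      then have "g a dvd x a - l a" "g a dvd l a"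
        using c g(3)[of l] dvd_mult_right[of 2 "int c" "x a - l a"] by simp_all
      then have "g a dvd (x a - l a) + l a" by (rule dvd_add)
      then show ?thesis by simp
    qed
    have "\<exists>l\<in>L'. \<forall>i\<in>I. x' i = l i"
    proof (rule insert.IH)
      show "(\<lambda>_. 0) \<in> L'" using zero by (auto simp: L'_def)
      show "(\<lambda>i. u i - v i) \<in> L'" if "u \<in> L'" "v \<in> L'" for u v
        using that diff[of u v] by (simp add: L'_def)
      fix q :: nat assume q: "q \<ge> 2"
      \<comment> \<open>Congruence modulo \<open>c * q\<close> at \<open>a\<close> leaves congruence
        modulo \<open>q\<close> after the division by \<open>g a = c\<close>, so the multiples of
        \<open>g\<close> that are subtracted agree modulo \<open>q\<close>.\<close>
      have "c * q \<ge> 2" using q c(1) mult_le_mono[of 1 c 2 q] by simp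
      from approx[OF this] obtain l where l: "l \<in> L" "\<And>i. i \<in> insert a I \<Longrightarrow> int (c * q) dvd x i - l i"
        by blast
      define l' where "l' = (\<lambda>i. l i - (l a div g a) * g i)"
      have "l' \<in> L"
        unfolding l'_def using diff[OF l(1) int_multiple_closed[OF zero diff g(1)]] .
      moreover have "l' a = 0"
        unfolding l'_def using dvd_div_mult_self[OF g(3)[OF l(1)]] by simp
      ultimately have "l' \<in> L'" by (simp add: L'_def)
      moreover have "int q dvd x' i - l' i" if i: "i \<in> I" for i
      proof -
        obtain k where k: "x a - l a = int (c * q) * k" using l(2)[of a] by auto
        have "(x a div g a - l a div g a) * g a = x a - l a"
          by (simp only: left_diff_distrib dvd_div_mult_self[OF xa] dvd_div_mult_self[OF g(3)[OF l(1)]])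
        also have "\<dots> = (int q * k) * g a" using k c(2) by simp
        finally have "x a div g a - l a div g a = int q * k"
          using False by simp
        moreover have "x' i - l' i = x i - l i - (x a div g a - l a div g a) * g i"
          by (simp add: x'_def l'_def algebra_simps)
        moreover have "int q dvd x i - l i"
          using l(2)[of i] i by (auto dest: dvd_mult_right)
        ultimately show ?thesis by (simp add: mult.assoc)
      qed
      ultimately show "\<exists>l\<in>L'. \<forall>i\<in>I. int q dvd x' i - l i" by blast
    qed
    then obtain l where l: "l \<in> L" "l a = 0" "\<And>i. i \<in> I \<Longrightarrow> x' i = l i"
      by (auto simp: L'_def)
    \<comment> \<open>Adds back the multiple of \<open>g\<close> removed in \<open>x'\<close>; it is
      written as a difference since \<open>L\<close> is only assumed closed under
      differences.\<close>
    define l' where "l' = (\<lambda>i. l i - (- (x a div g a)) * g i)"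
    have "l' \<in> L"
      unfolding l'_def using diff[OF l(1) int_multiple_closed[OF zero diff g(1)]] .
    moreover have "x i = l' i" if "i \<in> insert a I" for i
    proof (cases "i = a")
      case True
      then show ?thesis using l(2) dvd_div_mult_self[OF xa] by (simp add: l'_def)
    next
      case False
      then show ?thesis using that l(3)[of i] by (simp add: l'_def x'_def)
    qed
    ultimately show ?thesis by blast
  qed
qed

section \<open>The geometric action\<close>

locale small_coxeter =
  fixes W :: "('a, 'b) monoid_scheme" (structure)
    and n :: nat
    and m :: "nat \<Rightarrow> nat \<Rightarrow> enat"
    and w :: "nat \<Rightarrow> 'a"
  assumes small_system: "small_coxeter_system W n m w"
begin

lemma presentation: "has_presentation W {..<n} w (coxeter_relators n m)"
  and coxeter: "coxeter_matrix n m"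
  using small_system by (auto simp: small_coxeter_system_def coxeter_system_def)

sublocale group W
  using presentation by (simp add: has_presentation_def)

lemma w_closed [simp]: "i < n \<Longrightarrow> w i \<in> carrier W"
  using presentation by (auto simp: has_presentation_def)

lemma m_cases:
  assumes "i < n" "j < n"
  obtains "i = j" "m i j = 1" | "i \<noteq> j" "m i j = 2" | "i \<noteq> j" "m i j = 3" | "i \<noteq> j" "m i j = \<infinity>"
proof -
  have "m i j \<in> {1, 2, 3, \<infinity>}"
    using small_system assms by (simp add: small_coxeter_system_def)
  moreover have "m i j = 1 \<longleftrightarrow> i = j"
    using coxeter assms by (simp add: coxeter_matrix_def)
  moreover have "(2::enat) \<noteq> 1" "(3::enat) \<noteq> 1" by (simp_all add: one_enat_def numeral_eq_enat)
  ultimately show thesis using that by auto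
qed

lemma m_sym: "i < n \<Longrightarrow> j < n \<Longrightarrow> m i j = m j i"
  using coxeter by (auto simp: coxeter_matrix_def)

section \<open>The Gram matrix, the bilinear form and reflections\<close>

definition gram :: "nat \<Rightarrow> nat \<Rightarrow> real" where
  "gram i j = (case m i j of enat k \<Rightarrow> - cos (pi / real k) | \<infinity> \<Rightarrow> - 1)"

lemma gram_eq:
  "m i j = 1 \<Longrightarrow> gram i j = 1" "m i j = 2 \<Longrightarrow> gram i j = 0"
  "m i j = 3 \<Longrightarrow> gram i j = - 1 / 2" "m i j = \<infinity> \<Longrightarrow> gram i j = - 1"
  by (simp_all add: gram_def one_enat_def numeral_eq_enat cos_60)

lemma gram_sym: "i < n \<Longrightarrow> j < n \<Longrightarrow> gram i j = gram j i"
  using m_sym by (simp add: gram_def)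

lemma gram_diag [simp]: "i < n \<Longrightarrow> gram i i = 1"
  by (rule m_cases[of i i]) (auto simp: gram_eq)

lemma abs_gram_le_1: "i < n \<Longrightarrow> j < n \<Longrightarrow> \<bar>gram i j\<bar> \<le> 1"
  by (rule m_cases[of i j]) (auto simp: gram_eq)

lemma gram_half_int: "i < n \<Longrightarrow> j < n \<Longrightarrow> 2 * gram i j \<in> \<int>"
  by (rule m_cases[of i j]) (auto simp: gram_eq)

text \<open>Vectors are functions on all of \<open>nat\<close>; \<open>form\<close> reads only the
  coordinates below \<open>n\<close>, and \<open>W\<close> leaves the others unchanged
  (\<open>act_support\<close>).\<close>

definition unit :: "nat \<Rightarrow> nat \<Rightarrow> real" where
  "unit i k = (if k = i then 1 else 0)"

definition form :: "(nat \<Rightarrow> real) \<Rightarrow> (nat \<Rightarrow> real) \<Rightarrow> real" where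
  "form u v = (\<Sum>i<n. \<Sum>j<n. u i * gram i j * v j)"

definition reflection :: "(nat \<Rightarrow> real) \<Rightarrow> (nat \<Rightarrow> real) \<Rightarrow> nat \<Rightarrow> real" where
  "reflection a v = (\<lambda>k. v k - 2 * form a v * a k)"

lemma form_comb_left: "form (\<lambda>k. x * u k + y * u' k) v = x * form u v + y * form u' v"
  by (simp add: form_def sum_distrib_left sum.distrib algebra_simps)

lemma form_sym: "form u v = form v u"
proof -
  have "form u v = (\<Sum>i<n. \<Sum>j<n. v j * gram j i * u i)"
    unfolding form_def by (intro sum.cong refl) (auto simp: gram_sym)
  also have "\<dots> = form v u"
    unfolding form_def by (rule sum.swap)
  finally show ?thesis .
qed

lemma form_comb_right: "form v (\<lambda>k. x * u k + y * u' k) = x * form v u + y * form v u'"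
  by (subst (1 2 3) form_sym) (rule form_comb_left)

lemma form_diff_left: "form (\<lambda>k. u k - x * u' k) v = form u v - x * form u' v"
  using form_comb_left[of 1 u "- x" u' v] by simp

lemma form_diff_right: "form v (\<lambda>k. u k - x * u' k) = form v u - x * form v u'"
  using form_comb_right[of v 1 u "- x" u'] by simp

lemma form_unit_left: "i < n \<Longrightarrow> form (unit i) v = (\<Sum>j<n. gram i j * v j)"
  by (simp add: form_def unit_def mult.assoc flip: sum_distrib_left)
    (simp add: if_distribR if_distrib cong: if_cong)

lemma form_unit_unit [simp]: "i < n \<Longrightarrow> j < n \<Longrightarrow> form (unit i) (unit j) = gram i j"
  by (simp add: form_unit_left) (simp add: unit_def if_distrib cong: if_cong)

lemma form_expand_right: "form u v = (\<Sum>j<n. v j * form u (unit j))"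
proof -
  have "form u v = (\<Sum>j<n. \<Sum>i<n. u i * gram i j * v j)"
    unfolding form_def by (rule sum.swap)
  also have "\<dots> = (\<Sum>j<n. v j * form u (unit j))"
  proof (rule sum.cong)
    fix j assume j: "j \<in> {..<n}"
    have "form u (unit j) = (\<Sum>i<n. gram j i * u i)"
      using j by (subst form_sym) (simp add: form_unit_left)
    also have "\<dots> = (\<Sum>i<n. u i * gram i j)"
      using j by (intro sum.cong) (auto simp: gram_sym)
    finally show "(\<Sum>i<n. u i * gram i j * v j) = v j * form u (unit j)"
      by (simp add: sum_distrib_left algebra_simps)
  qed simp
  finally show ?thesis .
qed

lemma reflection_involution:
  assumes "form a a = 1"
  shows "reflection a (reflection a v) = v"
  using assms by (auto simp: reflection_def form_diff_right)

lemma reflection_form: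
  assumes "form a a = 1"
  shows "form (reflection a u) (reflection a v) = form u v"
  using assms by (simp add: reflection_def form_diff_right form_diff_left form_sym[of u a])

section \<open>The action of words and of \<open>W\<close>\<close>

abbreviation refl :: "nat \<Rightarrow> (nat \<Rightarrow> real) \<Rightarrow> nat \<Rightarrow> real" where
  "refl i \<equiv> reflection (unit i)"

text \<open>The sign of a letter is ignored, since every generator acts by an involution.\<close>

definition word_act :: "nat word \<Rightarrow> (nat \<Rightarrow> real) \<Rightarrow> nat \<Rightarrow> real" where
  "word_act u = foldr (\<lambda>x. refl (fst x)) u"

lemma word_act_simps [simp]:
  "word_act [] v = v"
  "word_act (x # u) v = refl (fst x) (word_act u v)"
  "word_act (u @ u') v = word_act u (word_act u' v)"
  by (simp_all add: word_act_def)

text \<open>One computation for each finite value of \<open>m i j\<close>: the square, the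
  commutation and the braid relation. An infinite value gives no relator.\<close>

lemma word_act_relator:
  assumes "r \<in> coxeter_relators n m"
  shows "word_act r v = v"
proof -
  obtain i j k where r: "r = concat (replicate k [(i, True), (j, True)])"
    and ij: "i < n" "j < n" and k: "m i j = enat k"
    using assms by (auto simp: coxeter_relators_def)
  from ij show ?thesis
  proof (cases rule: m_cases)
    case 1
    then have "k = 1" using k by (simp add: one_enat_def)
    then show ?thesis using r 1 ij by (simp add: reflection_involution)
  next
    case 2
    then have "k = 2" using k by (simp add: numeral_eq_enat)
    moreover have "gram i j = 0" "gram j i = 0" using 2 gram_eq gram_sym ij by metis+
    ultimately show ?thesis using r ij
      by (simp add: numeral_2_eq_2 reflection_def form_diff_right)
  next
    case 3
    then have "k = 3" using k by (simp add: numeral_eq_enat)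
    moreover have "gram i j = - 1 / 2" "gram j i = - 1 / 2" using 3 gram_eq gram_sym ij by metis+
    ultimately show ?thesis using r ij
      by (simp add: numeral_3_eq_3 reflection_def form_diff_right)
        (simp add: field_simps)
  next
    case 4
    then show ?thesis using k by simp
  qed
qed

lemma word_act_cong:
  assumes "pres_cong {..<n} (coxeter_relators n m) u u'"
  shows "word_act u v = word_act u' v"
  using assms
  by (induction arbitrary: v) (auto simp: word_act_relator reflection_involution)

text \<open>All relators have even length, so parity of length is an invariant of group elements.
  This later shows that multiplying by a generator always changes \<open>len\<close>.\<close>

lemma even_length_cong:
  assumes "pres_cong {..<n} (coxeter_relators n m) u u'"
  shows "even (length u) \<longleftrightarrow> even (length u')"
  using assms
proof induction
  case (relator r)
  then obtain i j k where "r = concat (replicate k [(i, True), (j, True)])"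
    by (auto simp: coxeter_relators_def)
  moreover have "even (length (concat (replicate k [(i, True), (j, True)])))"
    by (induction k) auto
  ultimately show ?case by simp
qed auto

lemma word_val_closed: "u \<in> words {..<n} \<Longrightarrow> word_val W w u \<in> carrier W"
  by (induction u) auto

lemma word_val_append:
  "u \<in> words {..<n} \<Longrightarrow> u' \<in> words {..<n} \<Longrightarrow>
    word_val W w (u @ u') = word_val W w u \<otimes> word_val W w u'"
proof (induction u)
  case Nil
  then show ?case by (simp add: word_val_closed)
next
  case (Cons x u)
  then have "fst x < n" "u \<in> words {..<n}" by (auto simp: Cons_in_lists_iff)
  then show ?case using Cons word_val_closed[of u] word_val_closed[of u'] by (simp add: m_assoc)
qed

lemma word_val_eq_iff:
  "u \<in> words {..<n} \<Longrightarrow> u' \<in> words {..<n} \<Longrightarrow>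
    word_val W w u = word_val W w u' \<longleftrightarrow> pres_cong {..<n} (coxeter_relators n m) u u'"
  using presentation by (auto simp: has_presentation_def)

text \<open>The chosen word is irrelevant on the carrier: congruent words act equally
  (\<open>act_word_val\<close>).\<close>

definition act :: "'a \<Rightarrow> (nat \<Rightarrow> real) \<Rightarrow> nat \<Rightarrow> real" where
  "act g = word_act (SOME u. u \<in> words {..<n} \<and> word_val W w u = g)"

lemma word_exists:
  assumes "g \<in> carrier W"
  shows "\<exists>u\<in>words {..<n}. word_val W w u = g"
proof -
  have "g \<in> word_val W w ` words {..<n}"
    using assms presentation by (simp add: has_presentation_def)
  then show ?thesis by (auto simp del: in_lists_conv_set)
qed

lemma act_word_val:
  assumes u: "u \<in> words {..<n}"
  shows "act (word_val W w u) v = word_act u v"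
proof -
  define u' where "u' = (SOME u'. u' \<in> words {..<n} \<and> word_val W w u' = word_val W w u)"
  have "u' \<in> words {..<n} \<and> word_val W w u' = word_val W w u"
    unfolding u'_def using u by (intro someI) auto
  then have "word_act u' v = word_act u v"
    using word_val_eq_iff u word_act_cong by blast
  then show ?thesis by (simp add: act_def u'_def)
qed

lemma act_mult:
  assumes "g \<in> carrier W" "h \<in> carrier W"
  shows "act (g \<otimes> h) v = act g (act h v)"
proof -
  obtain u u' where "u \<in> words {..<n}" "word_val W w u = g" "u' \<in> words {..<n}" "word_val W w u' = h"
    using word_exists assms by metis
  then show ?thesis
    by (metis act_word_val append_in_lists_conv word_act_simps(3) word_val_append)
qed

lemma act_one [simp]: "act \<one> v = v"
  using act_word_val[of "[]"] by simp

lemma act_gen [simp]: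
  assumes "i < n"
  shows "act (w i) v = refl i v"
  using act_word_val[of "[(i, True)]"] assms by simp

lemma gen_square [simp]:
  assumes "i < n"
  shows "w i \<otimes> w i = \<one>"
proof -
  have "m i i = enat 1" using coxeter assms by (simp add: coxeter_matrix_def one_enat_def)
  then have "[(i, True), (i, True)] \<in> coxeter_relators n m"
    unfolding coxeter_relators_def using assms
    by (intro CollectI exI[of _ i] exI[of _ "1::nat"]) simp
  then have "word_val W w [(i, True), (i, True)] = word_val W w []"
    using assms by (subst word_val_eq_iff) (auto intro: pres_cong.relator)
  then show ?thesis using assms by simp
qed

lemma inv_gen [simp]: "i < n \<Longrightarrow> inv (w i) = w i"
  by (simp add: inv_equality)

lemma carrier_induct [consumes 1, case_names one gen]:
  assumes "g \<in> carrier W" "P \<one>" "\<And>i g. i < n \<Longrightarrow> g \<in> carrier W \<Longrightarrow> P g \<Longrightarrow> P (w i \<otimes> g)"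
  shows "P g"
proof -
  have "P (word_val W w u)" if "u \<in> words {..<n}" for u
    using that
  proof (induction u)
    case Nil
    then show ?case using assms(2) by simp
  next
    case (Cons x u)
    then have "fst x < n" "u \<in> words {..<n}" by (auto simp: Cons_in_lists_iff)
    then show ?case using Cons.IH assms(3) word_val_closed[of u] by simp
  qed
  then show ?thesis using word_exists assms(1) by blast
qed

section \<open>Invariance, linearity and integrality of the action\<close>

lemma act_form: "g \<in> carrier W \<Longrightarrow> form (act g u) (act g v) = form u v"
  by (induction g arbitrary: u v rule: carrier_induct) (simp_all add: act_mult reflection_form)

lemma act_comb:
  "g \<in> carrier W \<Longrightarrow> act g (\<lambda>k. x * u k + y * v k) = (\<lambda>k. x * act g u k + y * act g v k)"
  by (induction g rule: carrier_induct)
    (auto simp: act_mult reflection_def form_comb_right algebra_simps)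

lemma act_diff:
  "g \<in> carrier W \<Longrightarrow> act g (\<lambda>k. u k - x * v k) = (\<lambda>k. act g u k - x * act g v k)"
  using act_comb[of g 1 u "- x" v] by simp

lemma act_scale: "g \<in> carrier W \<Longrightarrow> act g (\<lambda>k. x * u k) = (\<lambda>k. x * act g u k)"
  using act_comb[of g x u 0 u] by simp

lemma act_support: "g \<in> carrier W \<Longrightarrow> k \<ge> n \<Longrightarrow> act g v k = v k"
  by (induction g arbitrary: v rule: carrier_induct)
    (auto simp: act_mult reflection_def unit_def)

lemma act_inv [simp]: "g \<in> carrier W \<Longrightarrow> act (inv g) (act g v) = v"
  "g \<in> carrier W \<Longrightarrow> act g (act (inv g) v) = v"
  by (simp_all flip: act_mult)

lemma act_expand:
  assumes "g \<in> carrier W" "k < n"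
  shows "act g v k = (\<Sum>j<n. act g (unit j) k * v j)"
  using assms
proof (induction g arbitrary: k rule: carrier_induct)
  case one
  then show ?case by (simp add: unit_def if_distrib if_distribR cong: if_cong)
next
  case (gen i g)
  have "form (unit i) (act g v) = (\<Sum>l<n. gram i l * (\<Sum>j<n. act g (unit j) l * v j))"
    using gen by (simp add: form_unit_left)
  also have "\<dots> = (\<Sum>l<n. \<Sum>j<n. gram i l * act g (unit j) l * v j)"
    by (simp add: sum_distrib_left algebra_simps)
  also have "\<dots> = (\<Sum>j<n. \<Sum>l<n. gram i l * act g (unit j) l * v j)"
    by (rule sum.swap)
  also have "\<dots> = (\<Sum>j<n. form (unit i) (act g (unit j)) * v j)"
    using gen by (simp add: form_unit_left sum_distrib_right)
  finally have *: "form (unit i) (act g v) = (\<Sum>j<n. form (unit i) (act g (unit j)) * v j)" .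
  have "act (w i \<otimes> g) v k = (\<Sum>j<n. act g (unit j) k * v j)
      - 2 * (\<Sum>j<n. form (unit i) (act g (unit j)) * v j) * unit i k"
    using gen by (simp add: act_mult reflection_def *)
  also have "\<dots> = (\<Sum>j<n. act (w i \<otimes> g) (unit j) k * v j)"
    using gen by (simp add: act_mult reflection_def sum_distrib_left sum_distrib_right
        left_diff_distrib sum_subtractf algebra_simps)
  finally show ?case .
qed

text \<open>The numbers \<open>2 * gram i l\<close> are integers, so each simple reflection
  preserves integral vectors.\<close>

lemma act_integral:
  assumes "g \<in> carrier W"
  shows "act g (unit j) k \<in> \<int>"
  using assms
proof (induction g arbitrary: k rule: carrier_induct)
  case one
  then show ?case by (simp add: unit_def)
next
  case (gen i g)
  have "2 * form (unit i) (act g (unit j)) = (\<Sum>l<n. (2 * gram i l) * act g (unit j) l)"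
    using gen by (simp add: form_unit_left sum_distrib_left algebra_simps)
  also have "\<dots> \<in> \<int>"
    using gen by (intro Ints_sum Ints_mult gram_half_int) auto
  finally show ?case
    using gen by (auto simp: act_mult reflection_def unit_def[of i])
qed

text \<open>Discreteness of the pairings of roots with simple roots; with the bound
  \<open>root_form_le_1\<close> only finitely many values remain.\<close>

lemma form_act_half_int:
  assumes "g \<in> carrier W" "k < n"
  shows "2 * form (act g (unit j)) (unit k) \<in> \<int>"
proof -
  have "2 * form (act g (unit j)) (unit k) = (\<Sum>l<n. (2 * gram k l) * act g (unit j) l)"
    using assms by (subst form_sym) (simp add: form_unit_left sum_distrib_left algebra_simps)
  also have "\<dots> \<in> \<int>"
    using assms by (intro Ints_sum Ints_mult gram_half_int act_integral) auto
  finally show ?thesis .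
qed

end

section \<open>Faithfulness\<close>

text \<open>The alternating word always ends in \<open>t\<close> and grows at the front, so that it
  can serve as a suffix that is extended to the left.\<close>

primrec alternating :: "nat \<Rightarrow> nat \<Rightarrow> nat \<Rightarrow> nat list" where
  "alternating s t 0 = []"
| "alternating s t (Suc k) = (if even k then t else s) # alternating s t k"

lemma length_alternating [simp]: "length (alternating s t k) = k"
  by (induction k) auto

lemma set_alternating: "set (alternating s t k) \<subseteq> {s, t}"
  by (induction k) auto

text \<open>Exposes the letters that, once \<open>s\<close> is appended, can be shortened by the
  commutation relation; \<open>alternating_suffix3\<close> does the same for the braid
  relation.\<close>

lemma alternating_suffix2:
  "\<exists>ys. set ys \<subseteq> {s, t} \<and> length ys = k \<and> alternating s t (k + 2) = ys @ [s, t]"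
proof (induction k)
  case (Suc k)
  then obtain ys where "set ys \<subseteq> {s, t}" "length ys = k" "alternating s t (k + 2) = ys @ [s, t]"
    by blast
  then show ?case
    by (intro exI[of _ "(if even k then t else s) # ys"]) auto
qed simp

lemma alternating_suffix3:
  "\<exists>ys. set ys \<subseteq> {s, t} \<and> length ys = k \<and> alternating s t (k + 3) = ys @ [t, s, t]"
proof (induction k)
  case 0
  then show ?case by (simp add: numeral_3_eq_3)
next
  case (Suc k)
  then obtain ys where "set ys \<subseteq> {s, t}" "length ys = k" "alternating s t (k + 3) = ys @ [t, s, t]"
    by blast
  moreover have "alternating s t (Suc k + 3) = (if even (k + 3) then t else s) # alternating s t (k + 3)"
    by (simp only: add_Suc alternating.simps)
  ultimately show ?case
    by (intro exI[of _ "(if odd k then t else s) # ys"]) auto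
qed

context small_coxeter
begin

section \<open>The length function\<close>

definition gen_val :: "nat list \<Rightarrow> 'a" where
  "gen_val xs = word_val W w (map (\<lambda>i. (i, True)) xs)"

lemma gen_val_simps [simp]:
  "gen_val [] = \<one>"
  "gen_val (i # xs) = w i \<otimes> gen_val xs"
  by (simp_all add: gen_val_def)

lemma gen_val_closed [simp]: "set xs \<subseteq> {..<n} \<Longrightarrow> gen_val xs \<in> carrier W"
  by (induction xs) auto

lemma gen_val_append [simp]:
  "set xs \<subseteq> {..<n} \<Longrightarrow> set ys \<subseteq> {..<n} \<Longrightarrow> gen_val (xs @ ys) = gen_val xs \<otimes> gen_val ys"
  by (induction xs) (auto simp: m_assoc)

lemma gen_val_exists: "g \<in> carrier W \<Longrightarrow> \<exists>xs. set xs \<subseteq> {..<n} \<and> gen_val xs = g"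
proof (induction g rule: carrier_induct)
  case one
  then show ?case by (intro exI[of _ "[]"]) simp
next
  case (gen i g)
  then obtain xs where "set xs \<subseteq> {..<n}" "gen_val xs = g" by blast
  then show ?case using gen by (intro exI[of _ "i # xs"]) simp
qed

lemma gen_val_relator:
  assumes "i < n" "j < n" "m i j = enat k"
  shows "gen_val (concat (replicate k [i, j])) = \<one>"
proof -
  let ?r = "concat (replicate k [(i, True), (j, True)])"
  have "?r \<in> coxeter_relators n m"
    using assms by (auto simp: coxeter_relators_def)
  moreover from this have "?r \<in> words {..<n}"
    using presentation unfolding has_presentation_def by blast
  ultimately have "word_val W w ?r = word_val W w []"
    by (subst word_val_eq_iff) (auto intro: pres_cong.relator)
  then show ?thesis
    by (simp add: gen_val_def map_concat)
qed

text \<open>The Coxeter length. Words without inverse letters suffice, as the generators are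
  involutions.\<close>

definition len :: "'a \<Rightarrow> nat" where
  "len g = (LEAST k. \<exists>xs. set xs \<subseteq> {..<n} \<and> gen_val xs = g \<and> length xs = k)"

lemma reduced_word_exists:
  assumes "g \<in> carrier W"
  obtains xs where "set xs \<subseteq> {..<n}" "gen_val xs = g" "length xs = len g"
proof -
  have "\<exists>k xs. set xs \<subseteq> {..<n} \<and> gen_val xs = g \<and> length xs = k"
    using gen_val_exists[OF assms] by blast
  from LeastI_ex[OF this] show thesis
    using that unfolding len_def by blast
qed

lemma len_gen_val_le: "set xs \<subseteq> {..<n} \<Longrightarrow> len (gen_val xs) \<le> length xs"
  unfolding len_def by (rule Least_le) blast

lemma len_mult_gen_val_le:
  assumes "g \<in> carrier W" "set ys \<subseteq> {..<n}"
  shows "len (g \<otimes> gen_val ys) \<le> len g + length ys"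
proof -
  obtain xs where "set xs \<subseteq> {..<n}" "gen_val xs = g" "length xs = len g"
    using reduced_word_exists assms(1) by blast
  then show ?thesis using len_gen_val_le[of "xs @ ys"] assms by simp
qed

lemma even_len_gen_val:
  assumes "set xs \<subseteq> {..<n}"
  shows "even (len (gen_val xs)) \<longleftrightarrow> even (length xs)"
proof -
  obtain ys where ys: "set ys \<subseteq> {..<n}" "gen_val ys = gen_val xs" "length ys = len (gen_val xs)"
    using reduced_word_exists[OF gen_val_closed[OF assms]] by blast
  let ?f = "map (\<lambda>i. (i, True))"
  have "?f ys \<in> words {..<n}" "?f xs \<in> words {..<n}"
    using ys(1) assms by auto
  then have "pres_cong {..<n} (coxeter_relators n m) (?f ys) (?f xs)"
    using ys(2) word_val_eq_iff by (simp add: gen_val_def)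
  from even_length_cong[OF this] ys(3) show ?thesis by simp
qed

lemma len_mult_gen_neq:
  assumes "g \<in> carrier W" "i < n"
  shows "len (g \<otimes> w i) \<noteq> len g"
proof -
  obtain xs where "set xs \<subseteq> {..<n}" "gen_val xs = g" "length xs = len g"
    using reduced_word_exists assms(1) by blast
  then show ?thesis using even_len_gen_val[of "xs @ [i]"] assms by auto
qed

lemma gen_cancel [simp]: "g \<in> carrier W \<Longrightarrow> i < n \<Longrightarrow> g \<otimes> w i \<otimes> w i = g"
  by (simp add: m_assoc)

section \<open>Positivity for alternating words in two generators\<close>

lemma act_gen_val_Cons:
  "set (i # xs) \<subseteq> {..<n} \<Longrightarrow> act (gen_val (i # xs)) v = refl i (act (gen_val xs) v)"
  by (simp add: act_mult)

text \<open>Since \<open>gram s t = - 1\<close>, each reflection raises the smaller of the two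
  coefficients by 2, to one more than the other.\<close>

lemma act_alternating_infinite:
  assumes "s < n" "t < n" "m s t = \<infinity>"
  shows "act (gen_val (alternating s t k)) (unit s) =
    (\<lambda>i. (if even k then real k + 1 else real k) * unit s i
        + (if even k then real k else real k + 1) * unit t i)"
proof (induction k)
  case (Suc k)
  have "set (alternating s t (Suc k)) \<subseteq> {..<n}"
    using set_alternating[of s t "Suc k"] assms by auto
  moreover have "gram s t = - 1" "gram t s = - 1"
    using assms gram_eq gram_sym by metis+
  ultimately show ?case
    using assms unfolding alternating.simps
    by (subst act_gen_val_Cons)
      (auto simp: Suc reflection_def form_comb_right simp del: gen_val_simps, auto simp: algebra_simps)
qed simp

lemma act_alternating_short:
  assumes "s < n" "t < n"
  shows "m s t = 2 \<Longrightarrow> act (gen_val (alternating s t 1)) (unit s) = (\<lambda>i. unit s i)"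
    and "m s t = 3 \<Longrightarrow> act (gen_val (alternating s t 1)) (unit s) = (\<lambda>i. unit s i + unit t i)"
    and "m s t = 3 \<Longrightarrow> act (gen_val (alternating s t 2)) (unit s) = (\<lambda>i. unit t i)"
proof -
  have sym: "gram t s = gram s t" using assms gram_sym by simp
  show "m s t = 2 \<Longrightarrow> act (gen_val (alternating s t 1)) (unit s) = (\<lambda>i. unit s i)"
    "m s t = 3 \<Longrightarrow> act (gen_val (alternating s t 1)) (unit s) = (\<lambda>i. unit s i + unit t i)"
    using assms by (auto simp: reflection_def gram_eq sym)
  show "act (gen_val (alternating s t 2)) (unit s) = (\<lambda>i. unit t i)" if "m s t = 3"
    using assms that
    using form_comb_right[of "unit s" 1 "unit s" 1 "unit t"]
    by (auto simp: numeral_2_eq_2 act_mult reflection_def gram_eq sym)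
qed

text \<open>If the suffix were longer, appending \<open>s\<close> would allow the replacement of
  \<open>s t s\<close> by \<open>t\<close>, or of \<open>t s t s\<close> by \<open>s t\<close>, and
  \<open>g\<close> would become shorter, not longer.\<close>

lemma length_bound_of_reduced_alternating:
  assumes st: "s < n" "t < n" and v: "v \<in> carrier W"
    and g: "g = v \<otimes> gen_val (alternating s t k)" and len: "len v + k = len g"
    and longer: "len g < len (g \<otimes> w s)"
  shows "m s t = 2 \<Longrightarrow> k < 2" and "m s t = 3 \<Longrightarrow> k < 3"
proof -
  note rel = gen_val_relator[OF st]
  show "k < 2" if m: "m s t = 2"
  proof (rule ccontr)
    assume "\<not> k < 2"
    then obtain j where k: "k = j + 2" by (metis add.commute le_Suc_ex not_less)
    obtain ys where ys: "set ys \<subseteq> {s, t}" "length ys = j" "alternating s t k = ys @ [s, t]"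
      using alternating_suffix2[of s t j] k by blast
    have ysn: "set ys \<subseteq> {..<n}" using ys st by auto
    have "w s \<otimes> (w t \<otimes> (w s \<otimes> w t)) = \<one>"
      using rel[of 2] m st by (simp add: numeral_eq_enat numeral_2_eq_2)
    then have "w s \<otimes> (w t \<otimes> (w s \<otimes> w t)) \<otimes> w t = w t"
      using st by simp
    then have "w s \<otimes> (w t \<otimes> w s) = w t"
      using st by (simp add: m_assoc)
    then have "g \<otimes> w s = v \<otimes> gen_val (ys @ [t])"
      using g ys(3) ysn st v by (simp add: m_assoc)
    then have "len (g \<otimes> w s) \<le> len v + (j + 1)"
      using len_mult_gen_val_le[OF v, of "ys @ [t]"] ysn st ys(2) by simp
    then show False using longer len k by simp
  qed
  show "k < 3" if m: "m s t = 3"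
  proof (rule ccontr)
    assume "\<not> k < 3"
    then obtain j where k: "k = j + 3" by (metis add.commute le_Suc_ex not_less)
    obtain ys where ys: "set ys \<subseteq> {s, t}" "length ys = j" "alternating s t k = ys @ [t, s, t]"
      using alternating_suffix3[of s t j] k by blast
    have ysn: "set ys \<subseteq> {..<n}" using ys st by auto
    have "w s \<otimes> (w t \<otimes> (w s \<otimes> (w t \<otimes> (w s \<otimes> w t)))) = \<one>"
      using rel[of 3] m st by (simp add: numeral_eq_enat numeral_3_eq_3)
    \<comment> \<open>Multiplying the relator by \<open>w s\<close> on the left and by
      \<open>w t\<close> on the right turns it into \<open>t s t s = s t\<close>.\<close>
    then have "w s \<otimes> (w s \<otimes> (w t \<otimes> (w s \<otimes> (w t \<otimes> (w s \<otimes> w t))))) \<otimes> w t = w s \<otimes> w t"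
      using st by simp
    then have "w t \<otimes> (w s \<otimes> (w t \<otimes> w s)) = w s \<otimes> w t"
      using st by (simp add: m_assoc flip: m_assoc[of "w s" "w s"])
    then have "g \<otimes> w s = v \<otimes> gen_val (ys @ [s, t])"
      using g ys(3) ysn st v by (simp add: m_assoc)
    then have "len (g \<otimes> w s) \<le> len v + (j + 2)"
      using len_mult_gen_val_le[OF v, of "ys @ [s, t]"] ysn st ys(2) by simp
    then show False using longer len k by simp
  qed
qed

lemma act_alternating_nonneg:
  assumes st: "s < n" "t < n" "s \<noteq> t" and v: "v \<in> carrier W"
    and g: "g = v \<otimes> gen_val (alternating s t k)" and len: "len v + k = len g"
    and longer: "len g < len (g \<otimes> w s)" and k: "k > 0"
  obtains p q where "p \<ge> 0" "q \<ge> 0"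
    "act (gen_val (alternating s t k)) (unit s) = (\<lambda>i. p * unit s i + q * unit t i)"
  using st(1,2)
proof (cases rule: m_cases)
  case 1
  then show ?thesis using st by simp
next
  case 2
  then have "k = 1" using length_bound_of_reduced_alternating[OF st(1,2) v g len longer] k by simp
  then show ?thesis using act_alternating_short(1)[OF st(1,2)] 2 by (intro that[of 1 0]) simp_all
next
  case 3
  then have "k = 1 \<or> k = 2"
    using length_bound_of_reduced_alternating[OF st(1,2) v g len longer] k by fastforce
  then show ?thesis
    using act_alternating_short(2,3)[OF st(1,2)] 3 that[of 1 1] that[of 0 1] by auto
next
  case 4
  then show ?thesis
    using act_alternating_infinite[OF st(1,2), of k] by (intro that) auto
qed

text \<open>Split off from \<open>g\<close> the longest alternating suffix in \<open>s\<close> and the last letter \<open>t\<close>: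
  the remaining prefix is lengthened by both \<open>s\<close> and \<open>t\<close>, so induction applies to it.\<close>

lemma act_unit_nonneg:
  assumes "g \<in> carrier W" "s < n" "len g < len (g \<otimes> w s)"
  shows "act g (unit s) i \<ge> 0"
  using assms
proof (induction "len g" arbitrary: g s i rule: less_induct)
  case less
  note g = less.prems(1) and s = less.prems(2) and longer = less.prems(3)
  obtain xs where xs: "set xs \<subseteq> {..<n}" "gen_val xs = g" "length xs = len g"
    using reduced_word_exists g by blast
  show ?case
  proof (cases xs rule: rev_cases)
    case Nil
    then show ?thesis using xs by (auto simp: unit_def)
  next
    case (snoc ys t)
    then have t: "t < n" and ys: "set ys \<subseteq> {..<n}" using xs by auto
    have g_eq: "g = gen_val ys \<otimes> w t" using snoc xs ys t by simp
    have len_g: "len g = Suc (length ys)" using snoc xs by simp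
    have len_ys: "len (gen_val ys) = length ys"
      using len_gen_val_le[OF ys] len_mult_gen_val_le[of "gen_val ys" "[t]"] g_eq len_g ys t by simp
    have "g \<otimes> w t = gen_val ys" using g_eq ys t by simp
    then have st: "s \<noteq> t" using longer len_ys len_g by auto
    \<comment> \<open>The factorisations considered have additive length, which bounds
      \<open>k\<close> by \<open>len g\<close> and makes a maximal \<open>k\<close>
      available.\<close>
    define Q where "Q k \<longleftrightarrow>
      (\<exists>v\<in>carrier W. g = v \<otimes> gen_val (alternating s t k) \<and> len v + k = len g)" for k
    have "Q 1" unfolding Q_def using g_eq len_ys len_g ys t
      by (intro bexI[of _ "gen_val ys"]) simp_all
    moreover have "\<forall>k. Q k \<longrightarrow> k \<le> len g" unfolding Q_def by auto
    ultimately obtain k where k: "Q k" "\<And>k'. Q k' \<Longrightarrow> k' \<le> k"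
      using GreatestI_nat[of Q] Greatest_le_nat[of Q] by metis
    have "k \<ge> 1" using k(2)[OF \<open>Q 1\<close>] .
    then obtain j where j: "k = Suc j" by (cases k) auto
    obtain v where v: "v \<in> carrier W" "g = v \<otimes> gen_val (alternating s t k)" "len v + k = len g"
      using k(1) unfolding Q_def by blast
    \<comment> \<open>\<open>a\<close> is the first letter of the maximal suffix, and
      \<open>b\<close> is the letter that would prolong it on the left.\<close>
    define a b where "a = (if even j then t else s)" and "b = (if even j then s else t)"
    have ab: "a < n" "b < n" "{s, t} = {a, b}" using s t by (auto simp: a_def b_def)
    have altn: "set (alternating s t k') \<subseteq> {..<n}" for k'
      using set_alternating[of s t k'] s t by auto
    have "g = (v \<otimes> w a) \<otimes> gen_val (alternating s t j)"
      using v j ab altn[of j] by (simp add: a_def m_assoc)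
    then have "len g \<le> len (v \<otimes> w a) + j"
      using len_mult_gen_val_le[of "v \<otimes> w a" "alternating s t j"] v(1) ab altn by simp
    then have longer_a: "len v < len (v \<otimes> w a)" using v(3) j by simp
    \<comment> \<open>If \<open>b\<close> shortened \<open>v\<close>, it could be moved from
      \<open>v\<close> to the suffix, against the maximality of \<open>k\<close>.\<close>
    have longer_b: "len v < len (v \<otimes> w b)"
    proof (rule ccontr)
      assume "\<not> ?thesis"
      then have shorter: "len (v \<otimes> w b) < len v"
        using len_mult_gen_neq[OF v(1) ab(2)] by simp
      have "alternating s t (Suc k) = b # alternating s t k"
        using j by (simp add: b_def)
      then have "g = (v \<otimes> w b) \<otimes> gen_val (alternating s t (Suc k))"
        using v ab altn[of k] by (simp flip: m_assoc del: alternating.simps)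
      moreover from this have "len g \<le> len (v \<otimes> w b) + Suc k"
        using len_mult_gen_val_le[of "v \<otimes> w b" "alternating s t (Suc k)"] v(1) ab(2) altn
        by (metis length_alternating m_closed w_closed)
      ultimately have "Q (Suc k)"
        unfolding Q_def using shorter v ab(2) by (intro bexI[of _ "v \<otimes> w b"]) auto
      then show False using k(2) by fastforce
    qed
    have "len v < len g" using v(3) j by simp
    then have pos: "act v (unit s) i \<ge> 0" "act v (unit t) i \<ge> 0"
      using less.hyps[OF _ v(1)] longer_a longer_b ab by (auto simp: a_def b_def split: if_splits)
    obtain p q where pq: "p \<ge> 0" "q \<ge> 0"
      "act (gen_val (alternating s t k)) (unit s) = (\<lambda>i. p * unit s i + q * unit t i)"
      using act_alternating_nonneg[OF s t st v longer] \<open>k \<ge> 1\<close> by auto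
    have "act g (unit s) = act v (act (gen_val (alternating s t k)) (unit s))"
      using act_mult[OF v(1) gen_val_closed[OF altn]] v(2) by simp
    also have "\<dots> = (\<lambda>i. p * act v (unit s) i + q * act v (unit t) i)"
      unfolding pq(3) using act_comb[OF v(1)] .
    finally show ?thesis using pq pos by simp
  qed
qed

text \<open>If a reduced word of \<open>g\<close> ended in \<open>t\<close>, the prefix
  \<open>g \<otimes> w t\<close> would be lengthened by \<open>t\<close>, yet it sends
  \<open>unit t\<close> to its negative, contradicting \<open>act_unit_nonneg\<close>.\<close>

lemma act_faithful:
  assumes g: "g \<in> carrier W" and trivial: "\<And>i. i < n \<Longrightarrow> act g (unit i) = unit i"
  shows "g = \<one>"
proof -
  obtain xs where xs: "set xs \<subseteq> {..<n}" "gen_val xs = g" "length xs = len g"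
    using reduced_word_exists g by blast
  show ?thesis
  proof (cases xs rule: rev_cases)
    case Nil
    then show ?thesis using xs by simp
  next
    case (snoc ys t)
    then have t: "t < n" and ys: "set ys \<subseteq> {..<n}" using xs by auto
    have g_eq: "g = gen_val ys \<otimes> w t" using snoc xs ys t by simp
    have "len (gen_val ys) < len (gen_val ys \<otimes> w t)"
      using len_gen_val_le[OF ys] snoc xs g_eq by simp
    then have "act (gen_val ys) (unit t) t \<ge> 0"
      using act_unit_nonneg ys t by simp
    moreover have "gen_val ys = g \<otimes> w t" using g_eq ys t by simp
    then have "act (gen_val ys) (unit t) = act g (\<lambda>i. - 1 * unit t i)"
      using t g by (simp add: act_mult reflection_def)
    then have "act (gen_val ys) (unit t) t = - 1"
      using act_scale[OF g, of "- 1" "unit t"] trivial[OF t] by (simp add: unit_def)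
    ultimately show ?thesis by simp
  qed
qed

end

section \<open>The matrices of the Tits representation\<close>

context small_coxeter
begin

definition act_mat :: "'a \<Rightarrow> real mat" where
  "act_mat g = mat n n (\<lambda>(a, b). act g (unit b) a)"

lemma act_mat_carrier [simp]: "act_mat g \<in> carrier_mat n n"
  by (simp add: act_mat_def)

lemma act_mat_one: "act_mat \<one> = 1\<^sub>m n"
  by (rule eq_matI) (auto simp: act_mat_def unit_def)

lemma act_mat_mult:
  assumes "g \<in> carrier W" "h \<in> carrier W"
  shows "act_mat (g \<otimes> h) = act_mat g * act_mat h"
proof (rule eq_matI)
  fix a b assume "a < dim_row (act_mat g * act_mat h)" "b < dim_col (act_mat g * act_mat h)"
  then have ab: "a < n" "b < n" by (auto simp: act_mat_def)
  have "act (g \<otimes> h) (unit b) a = (\<Sum>j<n. act g (unit j) a * act h (unit b) j)"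
    using act_expand[OF assms(1) ab(1), of "act h (unit b)"] assms by (simp add: act_mult)
  then show "act_mat (g \<otimes> h) $$ (a, b) = (act_mat g * act_mat h) $$ (a, b)"
    using ab by (simp add: act_mat_def scalar_prod_def atLeast0LessThan)
qed (auto simp: act_mat_def)

lemma coxeter_form_unit_vec:
  assumes "i < n" "v \<in> carrier_vec n"
  shows "coxeter_form n m (unit_vec n i) v = form (unit i) (\<lambda>k. v $ k)"
proof -
  have "coxeter_gram n m *\<^sub>v v \<in> carrier_vec n"
    using assms by (intro mult_mat_vec_carrier[of _ n n]) (simp_all add: coxeter_gram_def)
  then have "coxeter_form n m (unit_vec n i) v = (coxeter_gram n m *\<^sub>v v) $ i"
    using assms by (simp add: coxeter_form_def)
  also have "\<dots> = form (unit i) (\<lambda>k. v $ k)"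
    using assms
    by (simp add: form_unit_left coxeter_gram_def gram_def scalar_prod_def atLeast0LessThan)
  finally show ?thesis .
qed

lemma act_mat_gen:
  assumes "i < n" "v \<in> carrier_vec n"
  shows "act_mat (w i) *\<^sub>v v
    = v - (2 * coxeter_form n m (unit_vec n i) v) \<cdot>\<^sub>v unit_vec n i"
proof (rule eq_vecI)
  fix k
  assume "k < dim_vec (v - (2 * coxeter_form n m (unit_vec n i) v) \<cdot>\<^sub>v unit_vec n i)"
  then have k: "k < n" by simp
  have "(act_mat (w i) *\<^sub>v v) $ k = (\<Sum>j<n. act (w i) (unit j) k * v $ j)"
    using assms k by (simp add: act_mat_def scalar_prod_def atLeast0LessThan)
  also have "\<dots> = act (w i) (\<lambda>j. v $ j) k"
    using assms k by (simp only: act_expand[of "w i" k "\<lambda>j. v $ j"] w_closed)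
  also have "\<dots> = v $ k - 2 * form (unit i) (\<lambda>j. v $ j) * unit i k"
    using assms by (simp add: reflection_def)
  finally show "(act_mat (w i) *\<^sub>v v) $ k
    = (v - (2 * coxeter_form n m (unit_vec n i) v) \<cdot>\<^sub>v unit_vec n i) $ k"
    using assms k by (simp add: coxeter_form_unit_vec unit_def)
qed (simp add: act_mat_def)

lemma mat_eq_of_mult_vec_eq:
  fixes A B :: "real mat"
  assumes A: "A \<in> carrier_mat n n" and B: "B \<in> carrier_mat n n"
    and eq: "\<And>v. v \<in> carrier_vec n \<Longrightarrow> A *\<^sub>v v = B *\<^sub>v v"
  shows "A = B"
proof (rule eq_matI)
  fix a b assume "a < dim_row B" "b < dim_col B"
  then have ab: "a < n" "b < n" using B by auto
  have "(A *\<^sub>v unit_vec n b) $ a = (B *\<^sub>v unit_vec n b) $ a"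
    using eq by simp
  then show "A $$ (a, b) = B $$ (a, b)"
    using A B ab by simp
qed (use A B in auto)

section \<open>Identification with \<open>tits_rep\<close>, and congruence subgroups\<close>

lemma GL_simps:
  "carrier (GL n) = Units (ring_mat TYPE(real) n ())"
  "monoid.mult (GL n) = (*)" "monoid.one (GL n) = 1\<^sub>m n"
  by (simp_all add: GL_def units_of_def ring_mat_simps)

lemma act_mat_in_GL:
  assumes "g \<in> carrier W"
  shows "act_mat g \<in> carrier (GL n)"
  using assms act_mat_mult[of g "inv g"] act_mat_mult[of "inv g" g]
  by (auto simp: GL_simps Units_def ring_mat_simps act_mat_one intro!: bexI[of _ "act_mat (inv g)"])

text \<open>The definite description is resolved by uniqueness: the prescribed effect on vectors
  fixes the matrix of each generator, and induction over products fixes the rest.\<close>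

lemma tits_rep_eq_act_mat:
  assumes "g \<in> carrier W"
  shows "tits_rep W n m w g = act_mat g"
proof -
  let ?P = "\<lambda>\<rho>. \<rho> \<in> hom W (GL n) \<and> \<rho> \<in> extensional (carrier W) \<and>
    (\<forall>i<n. \<forall>v\<in>carrier_vec n.
       \<rho> (w i) *\<^sub>v v = v - (2 * coxeter_form n m (unit_vec n i) v) \<cdot>\<^sub>v unit_vec n i)"
  have "?P (restrict act_mat (carrier W))"
    by (auto simp: hom_def act_mat_in_GL act_mat_mult act_mat_gen GL_simps(2))
  moreover have "\<rho> = restrict act_mat (carrier W)" if P: "?P \<rho>" for \<rho>
  proof (rule extensionalityI)
    interpret R: ring "ring_mat TYPE(real) n ()" by (rule ring_mat)
    have "group (GL n)"
      unfolding GL_def by (rule R.units_group)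
    then have "group_hom W (GL n) \<rho>"
      using P is_group unfolding group_hom_def group_hom_axioms_def by blast
    then interpret G: group_hom W "GL n" \<rho> .
    have mat: "\<rho> h \<in> carrier_mat n n" if "h \<in> carrier W" for h
      using G.hom_closed[OF that] by (auto simp: GL_simps Units_def ring_mat_simps)
    have gen: "\<rho> (w i) = act_mat (w i)" if "i < n" for i
    proof (rule mat_eq_of_mult_vec_eq)
      show "\<rho> (w i) *\<^sub>v v = act_mat (w i) *\<^sub>v v" if "v \<in> carrier_vec n" for v
        unfolding act_mat_gen[OF \<open>i < n\<close> that] using P that \<open>i < n\<close> by blast
    qed (use mat that in simp_all)
    fix h assume "h \<in> carrier W"
    then have "\<rho> h = act_mat h"
    proof (induction h rule: carrier_induct)
      case one
      then show ?case using G.hom_one by (simp add: GL_simps act_mat_one)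
    next
      case (gen i h)
      then show ?case
        using G.hom_mult[of "w i" h] \<open>\<And>i. i < n \<Longrightarrow> \<rho> (w i) = act_mat (w i)\<close>
        by (simp add: GL_simps act_mat_mult)
    qed
    then show "\<rho> h = restrict act_mat (carrier W) h" using \<open>h \<in> carrier W\<close> by simp
  qed (use P in auto)
  ultimately have "tits_rep W n m w = restrict act_mat (carrier W)"
    unfolding tits_rep_def by (intro the_equality) auto
  then show ?thesis using assms by simp
qed

text \<open>Allows finitely many moduli to be replaced by a common multiple.\<close>

lemma principal_congruence_antimono:
  assumes "q dvd q'"
  shows "principal_congruence_subgroup W n m w q' \<subseteq> principal_congruence_subgroup W n m w q"
proof -
  have "map_mat (\<lambda>a. a mod int q) A = map_mat (\<lambda>a. a mod int q) B"
    if eq: "map_mat (\<lambda>a. a mod int q') A = map_mat (\<lambda>a. a mod int q') B"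
    for A B :: "int mat"
  proof -
    have "map_mat (\<lambda>a. a mod int q) C
        = map_mat (\<lambda>a. a mod int q) (map_mat (\<lambda>a. a mod int q') C)" for C :: "int mat"
      by (rule eq_matI) (use assms in \<open>auto simp: mod_mod_cancel\<close>)
    then show ?thesis using eq by metis
  qed
  then show ?thesis unfolding principal_congruence_subgroup_def by blast
qed

lemma principal_congruence_act:
  assumes g: "g \<in> principal_congruence_subgroup W n m w q" and ab: "a < n" "b < n"
  obtains z where "act g (unit b) a = unit b a + real q * of_int z"
proof -
  obtain A where A: "A \<in> carrier_mat n n" "act_mat g = map_mat real_of_int A"
    and mod: "map_mat (\<lambda>a. a mod int q) A = map_mat (\<lambda>a. a mod int q) (1\<^sub>m n)"
    using g tits_rep_eq_act_mat by (auto simp: principal_congruence_subgroup_def)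
  have "A $$ (a, b) mod int q = 1\<^sub>m n $$ (a, b) mod int q"
    using arg_cong[OF mod, of "\<lambda>C. C $$ (a, b)"] A(1) ab by simp
  then have "int q dvd A $$ (a, b) - 1\<^sub>m n $$ (a, b)"
    by (rule mod_eq_dvd_iff[THEN iffD1])
  then obtain z where "A $$ (a, b) = 1\<^sub>m n $$ (a, b) + int q * z"
    by (metis dvd_def add.commute diff_add_cancel)
  moreover have "act g (unit b) a = of_int (A $$ (a, b))"
    using arg_cong[OF A(2), of "\<lambda>C. C $$ (a, b)"] A(1) ab by (simp add: act_mat_def)
  ultimately show thesis
    using that[of z] ab by (simp add: unit_def)
qed

end

section \<open>Virtually abelian groups\<close>

context group
begin

text \<open>Pigeonhole: two different powers of \<open>g\<close> lie in the same coset of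
  \<open>A\<close>.\<close>

lemma finite_index_pow_mem:
  assumes A: "finite_index_subgroup A G" and g: "g \<in> carrier G"
  obtains k :: nat where "k > 0" "g [^] k \<in> A"
proof -
  interpret A: subgroup A G using A by (simp add: finite_index_subgroup_def)
  have "range (\<lambda>k::nat. A #> g [^] k) \<subseteq> rcosets A"
    using g A.subset by (auto intro: rcosetsI)
  then have "finite (range (\<lambda>k::nat. A #> g [^] k))"
    using A finite_subset by (auto simp: finite_index_subgroup_def)
  then have "\<not> inj (\<lambda>k::nat. A #> g [^] k)"
    using finite_imageD by blast
  then obtain i j :: nat where ij: "i < j" "A #> g [^] i = A #> g [^] j"
    unfolding inj_def by (metis nat_neq_iff)
  have "g [^] j \<in> A #> g [^] i"
    using ij(2) rcos_self[OF _ A.subgroup_axioms, of "g [^] j"] g by simp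
  then obtain x where x: "x \<in> A" "g [^] j = x \<otimes> g [^] i"
    by (auto simp: r_coset_def)
  have "g [^] (j - i) \<otimes> g [^] i = x \<otimes> g [^] i"
    using ij(1) g x(2) by (simp add: nat_pow_mult)
  then have "g [^] (j - i) = x"
    using g x(1) A.mem_carrier by simp
  then show thesis using that[of "j - i"] ij(1) x(1) by simp
qed

text \<open>Some power of each element lies in the abelian subgroup; the product of the two
  exponents serves for both.\<close>

lemma virtually_abelian_commuting_powers:
  assumes "virtually_abelian G" and g: "g \<in> carrier G" and h: "h \<in> carrier G"
  obtains k :: nat where "k > 0" "g [^] k \<otimes> h [^] k = h [^] k \<otimes> g [^] k"
proof -
  obtain A where A: "finite_index_subgroup A G" and comm: "comm_group (G\<lparr>carrier := A\<rparr>)"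
    using assms(1) by (auto simp: virtually_abelian_def)
  interpret A: subgroup A G using A by (simp add: finite_index_subgroup_def)
  interpret C: comm_group "G\<lparr>carrier := A\<rparr>" by (rule comm)
  obtain k l :: nat where kl: "k > 0" "g [^] k \<in> A" "l > 0" "h [^] l \<in> A"
    using finite_index_pow_mem[OF A] g h by metis
  have pow: "x [^] (i::nat) \<in> A" if "x \<in> A" for x i
    using that by (induction i) auto
  have "g [^] (k * l) \<in> A" using pow[OF kl(2), of l] g by (simp add: nat_pow_pow)
  moreover have "h [^] (k * l) \<in> A" using pow[OF kl(4), of k] h by (simp add: nat_pow_pow mult.commute)
  ultimately have "g [^] (k * l) \<otimes> h [^] (k * l) = h [^] (k * l) \<otimes> g [^] (k * l)"
    using C.m_comm by simp
  then show thesis using that[of "k * l"] kl by simp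
qed

lemma conj_pow:
  assumes "g \<in> carrier G" "h \<in> carrier G"
  shows "(h \<otimes> g \<otimes> inv h) [^] (k::nat) = h \<otimes> g [^] k \<otimes> inv h"
proof (induction k)
  case (Suc k)
  have "inv h \<otimes> (h \<otimes> x) = x" if "x \<in> carrier G" for x
    using that assms by (simp flip: m_assoc)
  then show ?case using Suc assms by (simp add: m_assoc)
qed (use assms in simp)

end

section \<open>Boundedness of the form on roots\<close>

context small_coxeter
begin

definition roots :: "(nat \<Rightarrow> real) set" where
  "roots = {act g (unit i) | g i. g \<in> carrier W \<and> i < n}"

lemma unit_root: "i < n \<Longrightarrow> unit i \<in> roots"
  unfolding roots_def by (intro CollectI exI[of _ \<one>] exI[of _ i]) simp

lemma form_root_self: "a \<in> roots \<Longrightarrow> form a a = 1"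
  by (auto simp: roots_def act_form)

text \<open>The reflection in \<open>act g (unit i)\<close> is given by the conjugate of
  \<open>w i\<close> by \<open>g\<close>.\<close>

lemma root_reflection_in_W:
  assumes "a \<in> roots"
  obtains r where "r \<in> carrier W" "inv r = r" "\<And>v. act r v = reflection a v"
proof -
  obtain g i where g: "g \<in> carrier W" "i < n" "a = act g (unit i)"
    using assms by (auto simp: roots_def)
  have "act (g \<otimes> w i \<otimes> inv g) v = reflection a v" for v
  proof -
    have "act (g \<otimes> w i \<otimes> inv g) v = act g (refl i (act (inv g) v))"
      using g by (simp add: act_mult)
    also have "\<dots> = (\<lambda>k. v k - 2 * form (unit i) (act (inv g) v) * a k)"
      unfolding reflection_def act_diff[OF g(1)] using g by simp
    also have "form (unit i) (act (inv g) v) = form a v"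
      using act_form[OF g(1), of "unit i" "act (inv g) v"] g by simp
    finally show ?thesis by (simp add: reflection_def)
  qed
  moreover have "inv (g \<otimes> w i \<otimes> inv g) = g \<otimes> w i \<otimes> inv g"
    using g by (simp add: inv_mult_group m_assoc)
  ultimately show thesis using that[of "g \<otimes> w i \<otimes> inv g"] g by simp
qed

text \<open>If \<open>|form a b| > 1\<close>, the product \<open>t\<close> of the reflections in \<open>a\<close> and \<open>b\<close> has on the plane
  \<open>P\<close> spanned by \<open>a\<close> and \<open>b\<close> the isotropic eigenvectors \<open>a + s b\<close>, where \<open>s\<close> is a root of
  \<open>s\<^sup>2 + 2 c s + 1\<close>, \<open>c = form a b\<close>, with eigenvalue \<open>s\<^sup>-\<^sup>2 \<noteq> 1\<close>. Since a power of \<open>t\<close> commutes with its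
  conjugate by the reflection in a root \<open>r\<close>, this conjugate preserves the eigenline.\<close>

lemma root_orthogonal_or_in_plane:
  assumes va: "virtually_abelian W"
    and a: "a \<in> roots" and b: "b \<in> roots" and r: "r \<in> roots"
    and big: "\<bar>form a b\<bar> > 1" and s: "s\<^sup>2 + 2 * form a b * s + 1 = 0"
  shows "form r a + s * form r b = 0 \<or> (\<exists>p q. r = (\<lambda>i. p * a i + q * b i))"
proof -
  define c where "c = form a b"
  have s': "s * s + 2 * c * s + 1 = 0" using s by (simp add: c_def power2_eq_square)
  have s0: "s \<noteq> 0" using s' by auto
  \<comment> \<open>\<open>c + s\<close> vanishes only if \<open>s\<close> is a double root of the
    quadratic, that is, if \<open>c * c = 1\<close>.\<close>
  have cs: "c + s \<noteq> 0"
  proof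
    assume "c + s = 0"
    then have "s = - c" by simp
    then have "c * c = 1" using s' by simp
    then have "\<bar>c\<bar> = 1" by (metis abs_1 abs_mult_self_eq abs_square_eq_1 power2_eq_square)
    then show False using big by (simp add: c_def)
  qed
  have s1: "s\<^sup>2 \<noteq> 1"
  proof
    assume "s\<^sup>2 = 1"
    then have "c * s = - 1" using s by (simp add: c_def)
    moreover have "\<bar>s\<bar> = 1" using \<open>s\<^sup>2 = 1\<close> abs_square_eq_1 by blast
    ultimately show False using big abs_mult[of c s] by (simp add: c_def)
  qed
  note self [simp] = form_root_self[OF a] form_root_self[OF b] form_root_self[OF r]
  have ab: "form a b = c" "form b a = c" by (simp_all add: c_def form_sym)
  define v where "v = (\<lambda>i. 1 * a i + s * b i)"
  have form_v: "form u v = form u a + s * form u b" for u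
    unfolding v_def form_comb_right by simp
  have vv: "form v v = 0"
    unfolding form_v form_sym[of v] using s' by (simp add: form_v ab algebra_simps)
  obtain ra where ra: "ra \<in> carrier W" "\<And>v. act ra v = reflection a v"
    using root_reflection_in_W[OF a] by metis
  obtain rb where rb: "rb \<in> carrier W" "\<And>v. act rb v = reflection b v"
    using root_reflection_in_W[OF b] by metis
  obtain rr where rr: "rr \<in> carrier W" "inv rr = rr" "\<And>v. act rr v = reflection r v"
    using root_reflection_in_W[OF r] by metis
  define t where "t = ra \<otimes> rb"
  have t: "t \<in> carrier W" using ra rb by (simp add: t_def)
  have act_t: "act t u = reflection a (reflection b u)" for u
    using ra rb by (simp add: t_def act_mult)
  have act_t_v: "act t v = (\<lambda>i. (1 / s\<^sup>2) * v i)"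
  proof -
    have "form b v = c + s" by (simp add: form_v ab)
    then have bv: "reflection b v = (\<lambda>i. 1 * a i + (- (2 * c + s)) * b i)"
      by (simp add: reflection_def v_def algebra_simps)
    have fa: "form a (reflection b v) = 1 - (2 * c + s) * c"
      unfolding bv form_comb_right by (simp add: ab algebra_simps)
    have "act t v = (\<lambda>i. (2 * (2 * c + s) * c - 1) * a i + (- (2 * c + s)) * b i)"
      unfolding act_t reflection_def[of a] fa unfolding bv by (simp add: algebra_simps)
    \<comment> \<open>\<open>- (2 * c + s)\<close> is the other root of the quadratic, and the
      product of the roots is 1.\<close>
    moreover have e: "- (2 * c + s) = 1 / s"
      using s' s0 by (simp add: field_simps)
    moreover have "2 * (2 * c + s) * c - 1 = 1 / s\<^sup>2"
    proof -
      have "2 * (2 * c + s) * c - 1 = - 2 * (1 / s) * c - 1"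
        unfolding e[symmetric] by (simp add: algebra_simps)
      also have "\<dots> = (- (2 * c * s) - s * s) / s\<^sup>2"
        using s0 by (simp add: field_simps power2_eq_square)
      also have "- (2 * c * s) - s * s = 1" using s' by linarith
      finally show ?thesis .
    qed
    ultimately have "act t v = (\<lambda>i. 1 / s\<^sup>2 * a i + 1 / s * b i)" by simp
    then show ?thesis
      unfolding v_def using s0 by (simp add: field_simps power2_eq_square)
  qed
  obtain k :: nat where k: "k > 0"
    and comm: "t [^] k \<otimes> (rr \<otimes> t \<otimes> inv rr) [^] k = (rr \<otimes> t \<otimes> inv rr) [^] k \<otimes> t [^] k"
    using virtually_abelian_commuting_powers[OF va t, of "rr \<otimes> t \<otimes> inv rr"] rr t by auto
  define x where "x = t [^] k"
  have x: "x \<in> carrier W" using t by (simp add: x_def)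
  define y where "y = rr \<otimes> x \<otimes> rr"
  have y: "y \<in> carrier W" using x rr by (simp add: y_def)
  have xy: "x \<otimes> y = y \<otimes> x"
    using comm conj_pow[OF t rr(1)] rr(2) by (simp add: x_def y_def)
  have act_y: "act y u = reflection r (act x (reflection r u))" for u
    using x rr by (simp add: y_def act_mult)
  define \<mu> where "\<mu> = (1 / s\<^sup>2) ^ k"
  have act_x_v: "act x v = (\<lambda>i. \<mu> * v i)"
    unfolding x_def \<mu>_def
  proof (induction k)
    case (Suc k)
    have "act (t [^] Suc k) v = act (t [^] k) (\<lambda>i. (1 / s\<^sup>2) * v i)"
      using t by (simp add: act_mult act_t_v)
    also have "\<dots> = (\<lambda>i. (1 / s\<^sup>2) * act (t [^] k) v i)"
      using t by (intro act_scale) simp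
    finally show ?case by (simp add: Suc)
  qed simp
  have mu0: "\<mu> > 0" using s0 by (simp add: \<mu>_def)
  have mu1: "\<mu> \<noteq> 1"
    using power_eq_imp_eq_base[of "1 / s\<^sup>2" k 1] k s1 s0 by (auto simp: \<mu>_def)
  have mu2: "\<mu> * \<mu> \<noteq> 1"
    using mu0 mu1 by (metis abs_of_pos abs_square_eq_1 power2_eq_square)
  \<comment> \<open>Both reflections move a vector by an element of the plane, so powers of
    \<open>t\<close> act trivially modulo the plane.\<close>
  have move: "\<exists>p q. act x u = (\<lambda>i. u i + p * a i + q * b i)" for u
    unfolding x_def
  proof (induction k arbitrary: u)
    case 0
    then show ?case by (intro exI[of _ 0]) simp
  next
    case (Suc k)
    obtain p q where pq: "act (t [^] k) (act t u) = (\<lambda>i. act t u i + p * a i + q * b i)"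
      using Suc by blast
    have "act (t [^] Suc k) u = (\<lambda>i. u i + (p - 2 * form a (reflection b u)) * a i
        + (q - 2 * form b u) * b i)"
      using t by (simp add: act_mult pq) (simp add: act_t reflection_def algebra_simps)
    then show ?case by blast
  qed
  \<comment> \<open>Consequently an eigenvector of \<open>x\<close> with eigenvalue other than 1
    lies in the plane.\<close>
  have eigen: "\<exists>p q. u = (\<lambda>i. p * a i + q * b i)"
    if eq: "act x u = (\<lambda>i. \<nu> * u i)" and nu: "\<nu> \<noteq> 1" for u \<nu>
  proof -
    obtain p q where pq: "act x u = (\<lambda>i. u i + p * a i + q * b i)" using move by blast
    have "u i = p / (\<nu> - 1) * a i + q / (\<nu> - 1) * b i" for i
    proof -
      have "\<nu> * u i = u i + p * a i + q * b i" using eq pq by metis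
      then have "u i = (p * a i + q * b i) / (\<nu> - 1)"
        using nu by (simp add: nonzero_eq_divide_eq algebra_simps)
      then show ?thesis by (simp add: add_divide_distrib)
    qed
    then show ?thesis by blast
  qed
  \<comment> \<open>As \<open>x\<close> and \<open>y\<close> commute, \<open>y\<close> preserves the
    eigenspace of \<open>x\<close> for \<open>\<mu>\<close>.\<close>
  have "act x (act y v) = (\<lambda>i. \<mu> * act y v i)"
    using act_mult[OF x y, of v] act_mult[OF y x, of v] xy act_x_v act_scale[OF y] by simp
  note y_eig = this
  obtain p q where pq: "act y v = (\<lambda>i. p * a i + q * b i)"
    using eigen[OF y_eig mu1] by blast
  \<comment> \<open>Two eigenvectors for \<open>\<mu>\<close> are orthogonal by invariance of the
    form, because \<open>\<mu> * \<mu>\<close> is not 1.\<close>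
  have "form (act y v) v = \<mu> * \<mu> * form (act y v) v"
  proof -
    have "form (act y v) v = form (act x (act y v)) (act x v)" using act_form[OF x] by simp
    also have "\<dots> = \<mu> * \<mu> * form (act y v) v"
      unfolding y_eig act_x_v
      using form_comb_left[of \<mu> "act y v" 0 "act y v"] form_comb_right[of _ \<mu> v 0 v] by simp
    finally show ?thesis .
  qed
  then have "form (act y v) v = 0" using mu2 by simp
  then have y_v_orth: "p * (1 + s * c) + q * (c + s) = 0"
    unfolding pq form_comb_left by (simp add: form_v ab)
  \<comment> \<open>This reads \<open>form v a = - s * form v b\<close>. Hence the only vectors of
    the plane orthogonal to \<open>v\<close> are its multiples, and \<open>act y v\<close> is one of
    them.\<close>
  have line: "1 + s * c = - s * (c + s)" using s' by (simp add: algebra_simps)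
  have "(c + s) * (q - p * s) = p * (1 + s * c) + q * (c + s)"
    unfolding line by (simp add: algebra_simps)
  then have "(c + s) * (q - p * s) = 0" using y_v_orth by simp
  then have "q = p * s" using cs by simp
  then have y_v: "act y v = (\<lambda>i. p * v i)"
    using pq by (simp add: v_def algebra_simps)
  define u where "u = reflection r v"
  have "act x u = reflection r (act y v)"
    unfolding act_y u_def by (simp add: reflection_involution)
  also have "\<dots> = (\<lambda>i. p * u i)"
    unfolding y_v rr(3)[symmetric] u_def using act_scale[OF rr(1)] by simp
  finally have x_u: "act x u = (\<lambda>i. p * u i)" .
  have u: "u = (\<lambda>i. v i - 2 * form r v * r i)" by (simp add: u_def reflection_def)
  show ?thesis
  proof (cases "p = 1")
    case True
    \<comment> \<open>Eigenvectors for 1 and for \<open>\<mu>\<close> are orthogonal; as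
      \<open>v\<close> is isotropic, \<open>form u v\<close> equals
      \<open>- 2 * (form r v)\<^sup>2\<close>.\<close>
    have "form u v = form (act x u) (act x v)" using act_form[OF x] by simp
    also have "\<dots> = \<mu> * form u v"
      unfolding x_u act_x_v using True form_comb_right[of u \<mu> v 0 v] by simp
    finally have "form u v = 0" using mu1 by simp
    then have "form r v = 0" unfolding u form_diff_left by (simp add: vv)
    then show ?thesis by (simp add: form_v)
  next
    case False
    \<comment> \<open>Now \<open>u\<close> and \<open>v\<close> both lie in the plane, and they
      differ by a multiple of \<open>r\<close>.\<close>
    obtain p' q' where u': "u = (\<lambda>i. p' * a i + q' * b i)"
      using eigen[OF x_u False] by blast
    show ?thesis
    proof (cases "form r v = 0")
      case True
      then show ?thesis by (simp add: form_v)
    next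
      case nz: False
      have "r i = (1 - p') / (2 * form r v) * a i + (s - q') / (2 * form r v) * b i" for i
      proof -
        have "v i - 2 * form r v * r i = p' * a i + q' * b i" using u u' by metis
        then have "r i = ((1 - p') * a i + (s - q') * b i) / (2 * form r v)"
          using nz by (simp add: v_def nonzero_eq_divide_eq algebra_simps)
        then show ?thesis by (simp add: add_divide_distrib)
      qed
      then show ?thesis by blast
    qed
  qed
qed

text \<open>Gram determinants change by the square of the determinant of the change of basis. That
  of \<open>a\<close> and \<open>b\<close> is \<open>1 - c\<^sup>2 < 0\<close>, whereas that of two
  simple roots is nonnegative; so the determinant is zero and the simple roots would be linearly
  dependent.\<close>

lemma unit_plane_unique:
  assumes "a \<in> roots" "b \<in> roots" and big: "\<bar>form a b\<bar> > 1"
    and i: "i < n" "unit i = (\<lambda>k. p * a k + q * b k)"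
    and j: "j < n" "unit j = (\<lambda>k. p' * a k + q' * b k)"
  shows "i = j"
proof (rule ccontr)
  assume ij: "i \<noteq> j"
  define c where "c = form a b"
  have ab: "form a a = 1" "form b b = 1" "form a b = c" "form b a = c"
    using assms(1,2) by (simp_all add: c_def form_sym form_root_self)
  have "form (unit i) (unit i) = p * p + 2 * p * q * c + q * q"
    unfolding i(2) form_comb_left form_comb_right by (simp add: ab algebra_simps)
  then have ii: "p * p + 2 * p * q * c + q * q = 1" using i(1) by simp
  have "form (unit j) (unit j) = p' * p' + 2 * p' * q' * c + q' * q'"
    unfolding j(2) form_comb_left form_comb_right by (simp add: ab algebra_simps)
  then have jj: "p' * p' + 2 * p' * q' * c + q' * q' = 1" using j(1) by simp
  have gij: "gram i j = p * p' + (p * q' + q * p') * c + q * q'"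
    using form_unit_unit[OF i(1) j(1)]
    unfolding i(2) j(2) form_comb_left form_comb_right by (simp add: ab algebra_simps)
  have "(p * q' - q * p')\<^sup>2 * (1 - c\<^sup>2)
      = (p * p + 2 * p * q * c + q * q) * (p' * p' + 2 * p' * q' * c + q' * q') - (gram i j)\<^sup>2"
    unfolding gij by (simp add: power2_eq_square algebra_simps)
  also have "\<dots> = 1 - (gram i j)\<^sup>2" unfolding ii jj by simp
  also have "\<dots> \<ge> 0"
    using abs_gram_le_1[OF i(1) j(1)] by (simp add: abs_square_le_1)
  finally have "(p * q' - q * p')\<^sup>2 * (1 - c\<^sup>2) \<ge> 0" .
  moreover have "1 - c\<^sup>2 < 0"
    using big abs_square_le_1[of c] by (auto simp: c_def)
  ultimately have "(p * q' - q * p')\<^sup>2 \<le> 0"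
    by (simp add: zero_le_mult_iff)
  then have det: "p * q' = q * p'" by simp
  have "q' * unit i k - q * unit j k = 0" for k
  proof -
    have "q' * unit i k - q * unit j k = (p * q' - q * p') * a k"
      unfolding i(2) j(2) by (simp add: algebra_simps)
    then show ?thesis using det by simp
  qed
  from this[of i] this[of j] have q: "q' = 0" "q = 0" using ij by (auto simp: unit_def)
  have "p' * unit i k - p * unit j k = 0" for k
    unfolding i(2) j(2) using q by simp
  from this[of i] this[of j] have "p' = 0" "p = 0" using ij by (auto simp: unit_def)
  then show False using ii q by simp
qed

text \<open>Simple roots outside the plane are orthogonal to \<open>a\<close> and \<open>b\<close>,
  and at most one simple root \<open>j\<close> lies in it. Thus pairings with \<open>a\<close> and
  \<open>b\<close> see only the coordinate \<open>j\<close>, so the Gram matrix of \<open>a\<close>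
  and \<open>b\<close> has rank at most one and \<open>c * c = 1\<close>.\<close>

lemma root_form_le_1:
  assumes va: "virtually_abelian W" and a: "a \<in> roots" and b: "b \<in> roots"
  shows "\<bar>form a b\<bar> \<le> 1"
proof (rule ccontr)
  assume "\<not> ?thesis"
  then have big: "\<bar>form a b\<bar> > 1" by simp
  define c where "c = form a b"
  define J where "J = {i. i < n \<and> (\<exists>p q. unit i = (\<lambda>k. p * a k + q * b k))}"
  have outside: "form (unit i) a = 0 \<and> form (unit i) b = 0" if i: "i < n" "i \<notin> J" for i
  proof -
    have c2: "c\<^sup>2 > 1" using big abs_square_le_1[of c] by (auto simp: c_def)
    \<comment> \<open>The roots of the quadratic are \<open>- c + d\<close> and
      \<open>- c - d\<close>; orthogonality to both eigenvectors amounts to orthogonality to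
      \<open>a\<close> and to \<open>b\<close>.\<close>
    define d where "d = sqrt (c\<^sup>2 - 1)"
    have d: "d\<^sup>2 = c\<^sup>2 - 1" "d > 0" using c2 by (simp_all add: d_def)
    have "(- c + d)\<^sup>2 + 2 * form a b * (- c + d) + 1 = 0"
      "(- c - d)\<^sup>2 + 2 * form a b * (- c - d) + 1 = 0"
      using d(1) by (simp_all add: c_def power2_eq_square algebra_simps)
    from this[THEN root_orthogonal_or_in_plane[OF va a b unit_root[OF i(1)] big]]
    have "form (unit i) a + (- c + d) * form (unit i) b = 0"
      "form (unit i) a + (- c - d) * form (unit i) b = 0"
      using i by (auto simp: J_def)
    moreover from this have "d * form (unit i) b = 0" by (simp add: algebra_simps)
    ultimately show ?thesis using d(2) by simp
  qed
  have expand: "form u v = (\<Sum>i\<in>J. v i * form u (unit i))" if "u = a \<or> u = b" for u v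
  proof -
    have "form u v = (\<Sum>i<n. v i * form u (unit i))" by (rule form_expand_right)
    also have "\<dots> = (\<Sum>i\<in>J. v i * form u (unit i))"
    proof (rule sum.mono_neutral_right)
      show "\<forall>i\<in>{..<n} - J. v i * form u (unit i) = 0"
        using that outside by (auto simp: form_sym[of a] form_sym[of b])
    qed (auto simp: J_def)
    finally show ?thesis .
  qed
  have one: "form a a = 1" "form b b = 1" using a b form_root_self by auto
  have "J \<noteq> {}" using expand[of a a] one by auto
  then obtain j where j: "j \<in> J" by blast
  have "J = {j}"
    using j unit_plane_unique[OF a b big] unfolding J_def by blast
  then have "1 = a j * form a (unit j)" "c = b j * form a (unit j)"
    "c = a j * form b (unit j)" "1 = b j * form b (unit j)"
    using expand[of a a] expand[of a b] expand[of b a] expand[of b b] one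
    by (simp_all add: c_def form_sym)
  then have "c * c = (a j * form a (unit j)) * (b j * form b (unit j))"
    by (metis mult.assoc mult.commute)
  also have "\<dots> = 1"
    using \<open>1 = a j * form a (unit j)\<close> \<open>1 = b j * form b (unit j)\<close> by simp
  finally have "\<bar>c\<bar> = 1" by (metis abs_square_eq_1 power2_eq_square)
  then show False using big by (simp add: c_def)
qed

end

section \<open>The kernel of the action modulo the radical\<close>

context small_coxeter
begin

text \<open>These pairings determine the action of \<open>g\<close> modulo the radical; the
  restriction to a finite index set makes a finite range possible.\<close>

definition gram_data :: "'a \<Rightarrow> nat \<times> nat \<Rightarrow> real" where
  "gram_data g = (\<lambda>(j, k)\<in>{..<n} \<times> {..<n}. form (act g (unit j)) (unit k))"

lemma finite_range_gram_data:
  assumes "virtually_abelian W"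
  shows "finite (gram_data ` carrier W)"
proof -
  have "gram_data g \<in> ({..<n} \<times> {..<n}) \<rightarrow>\<^sub>E (\<lambda>z. real_of_int z / 2) ` {- 2..2}"
    if g: "g \<in> carrier W" for g
  proof -
    have "form (act g (unit j)) (unit k) \<in> (\<lambda>z. real_of_int z / 2) ` {- 2..2}"
      if jk: "j < n" "k < n" for j k
    proof -
      obtain z where z: "2 * form (act g (unit j)) (unit k) = of_int z"
        using form_act_half_int[OF g jk(2)] by (auto elim: Ints_cases)
      have "act g (unit j) \<in> roots" using g jk by (auto simp: roots_def)
      then have "\<bar>form (act g (unit j)) (unit k)\<bar> \<le> 1"
        using root_form_le_1[OF assms] unit_root jk by blast
      then have "\<bar>real_of_int z\<bar> \<le> 2" using z by linarith
      then have "z \<in> {- 2..2}" by auto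
      moreover have "form (act g (unit j)) (unit k) = real_of_int z / 2" using z by simp
      ultimately show ?thesis by blast
    qed
    then show ?thesis by (auto simp: gram_data_def)
  qed
  then have "gram_data ` carrier W
      \<subseteq> ({..<n} \<times> {..<n}) \<rightarrow>\<^sub>E (\<lambda>z. real_of_int z / 2) ` {- 2..2}"
    by blast
  then show ?thesis by (rule finite_subset) (intro finite_PiE; simp)
qed

text \<open>The kernel of the action on the quotient of the space by the radical of the
  form.\<close>

definition radical_kernel :: "'a set" where
  "radical_kernel = {g \<in> carrier W. \<forall>j<n. \<forall>v. form (act g (unit j)) v = form (unit j) v}"

text \<open>The images of \<open>unit j\<close> under \<open>g\<close> and \<open>h\<close> pair
  equally with all vectors; applying \<open>inv g\<close> to both sides gives the claim.\<close>

lemma radical_kernel_of_gram_data: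
  assumes g: "g \<in> carrier W" "h \<in> carrier W" and eq: "gram_data g = gram_data h"
  shows "inv g \<otimes> h \<in> radical_kernel"
proof -
  have "form (act (inv g \<otimes> h) (unit j)) v = form (unit j) v" if j: "j < n" for j v
  proof -
    have "form (act h (unit j)) (unit k) = form (act g (unit j)) (unit k)" if "k < n" for k
      using fun_cong[OF eq, of "(j, k)"] j that by (simp add: gram_data_def)
    then have "form (act h (unit j)) (act g v) = form (act g (unit j)) (act g v)"
      unfolding form_expand_right[of _ "act g v"] by simp
    also have "\<dots> = form (unit j) v" using g(1) by (rule act_form)
    finally show ?thesis
      using act_form[OF g(1), of "act (inv g) (act h (unit j))" v] g by (simp add: act_mult)
  qed
  then show ?thesis using g by (simp add: radical_kernel_def)
qed

lemma act_fixes_radical: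
  assumes "g \<in> carrier W" "\<And>v. form d v = 0"
  shows "act g d = d"
  using assms by (induction g rule: carrier_induct) (simp_all add: act_mult reflection_def form_sym[of _ d])

text \<open>On this kernel \<open>g \<mapsto> g - 1\<close> takes values in the maps into the radical that vanish on the
  radical, and is therefore additive.\<close>

lemma radical_kernel_diff:
  assumes g: "g \<in> radical_kernel" and h: "h \<in> radical_kernel" and j: "j < n"
  shows "act (g \<otimes> inv h) (unit j) i - unit j i
    = (act g (unit j) i - unit j i) - (act h (unit j) i - unit j i)"
proof -
  have gh: "g \<in> carrier W" "h \<in> carrier W" using g h by (auto simp: radical_kernel_def)
  \<comment> \<open>\<open>d\<close> lies in the radical and is therefore fixed by \<open>W\<close>,
    so \<open>inv h\<close> sends \<open>unit j\<close> to \<open>unit j\<close> minus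
    \<open>d\<close>. The factor 1 matches the shape of \<open>form_diff_left\<close> and
    \<open>act_diff\<close>.\<close>
  define d where "d = (\<lambda>k. act h (unit j) k - 1 * unit j k)"
  have d0: "form d v = 0" for v
    unfolding d_def form_diff_left using h j by (simp add: radical_kernel_def)
  have d: "act k d = d" if "k \<in> carrier W" for k
    using act_fixes_radical[OF that d0] .
  have unit_j: "unit j = (\<lambda>k. act h (unit j) k - 1 * d k)" by (simp add: d_def)
  have "act (inv h) (unit j) = act (inv h) (\<lambda>k. act h (unit j) k - 1 * d k)"
    using unit_j by simp
  also have "\<dots> = (\<lambda>k. unit j k - 1 * d k)"
    using gh by (subst act_diff) (simp_all add: d)
  finally have "act (g \<otimes> inv h) (unit j) = (\<lambda>k. act g (unit j) k - 1 * d k)"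
    using gh by (simp add: act_mult act_diff d del: mult_1)
  then show ?thesis by (simp add: d_def)
qed

lemma radical_kernel_mult_inv_closed:
  assumes "g \<in> radical_kernel" "h \<in> radical_kernel"
  shows "g \<otimes> inv h \<in> radical_kernel"
proof -
  have gh: "g \<in> carrier W" "h \<in> carrier W" using assms by (auto simp: radical_kernel_def)
  have "form (act (g \<otimes> inv h) (unit j)) v = form (unit j) v" if j: "j < n" for j v
  proof -
    have "act (g \<otimes> inv h) (unit j)
        = (\<lambda>i. 1 * (\<lambda>i. 1 * unit j i + 1 * act g (unit j) i) i + (- 1) * act h (unit j) i)"
      using radical_kernel_diff[OF assms j] by (auto simp: fun_eq_iff algebra_simps)
    then have "form (act (g \<otimes> inv h) (unit j)) v
        = form (unit j) v + form (act g (unit j)) v - form (act h (unit j)) v"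
      by (simp only: form_comb_left) simp
    then show ?thesis using assms j by (simp add: radical_kernel_def)
  qed
  then show ?thesis using gh by (simp add: radical_kernel_def)
qed

section \<open>The congruence subgroup property\<close>

text \<open>Otherwise \<open>inv f\<close> would be congruent, for every modulus, to some element of
  \<open>H \<inter> radical_kernel\<close>. Separability then yields one element with the same
  matrix as \<open>inv f\<close>, and faithfulness puts \<open>f\<close> in
  \<open>H\<close>.\<close>

lemma coset_avoids_principal_congruence:
  assumes H: "subgroup H W" and f: "f \<in> carrier W" "f \<notin> H"
  obtains q where "q \<ge> 2"
    "\<And>h. h \<in> H \<inter> radical_kernel \<Longrightarrow> f \<otimes> h \<notin> principal_congruence_subgroup W n m w q"
proof (rule ccontr)
  assume contr: "\<not> thesis"
  note avoids = that
  interpret H: subgroup H W by (rule H)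
  \<comment> \<open>The entries of \<open>g - 1\<close>; the floors are exact by integrality. The
    default 0 for \<open>b \<ge> n\<close> lets \<open>\<nu>\<close> turn quotients into differences
    at all indices, as \<open>radical_kernel_diff\<close> covers only \<open>b < n\<close>.\<close>
  define \<nu> :: "'a \<Rightarrow> nat \<times> nat \<Rightarrow> int"
    where "\<nu> g = (\<lambda>(a, b). if b < n then \<lfloor>act g (unit b) a\<rfloor> - \<lfloor>unit b a\<rfloor> else 0)" for g
  have of_\<nu>: "real_of_int (\<nu> g (a, b)) = act g (unit b) a - unit b a"
    if "g \<in> carrier W" "b < n" for g a b
    using act_integral[OF that(1), of b a] act_integral[OF one_closed, of b a] that(2)
    by (simp add: \<nu>_def)
  define I where "I = {..<n} \<times> {..<n}"
  define K where "K = H \<inter> radical_kernel"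
  have K_carrier: "h \<in> carrier W" if "h \<in> K" for h using that by (simp add: K_def)
  have "\<exists>l\<in>\<nu> ` K. \<forall>p\<in>I. \<nu> (inv f) p = l p"
  proof (rule int_subgroup_separable)
    show "finite I" by (simp add: I_def)
    have "\<one> \<in> K" by (simp add: K_def radical_kernel_def)
    moreover have "\<nu> \<one> = (\<lambda>_. 0)" by (auto simp: \<nu>_def)
    ultimately show "(\<lambda>_. 0) \<in> \<nu> ` K" by (metis image_eqI)
    show "(\<lambda>i. u i - v i) \<in> \<nu> ` K" if uv: "u \<in> \<nu> ` K" "v \<in> \<nu> ` K" for u v
    proof -
      obtain g h where gh: "g \<in> K" "u = \<nu> g" "h \<in> K" "v = \<nu> h" using uv by blast
      have "g \<otimes> inv h \<in> K"
        using gh radical_kernel_mult_inv_closed by (simp add: K_def)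
      moreover have "\<nu> g p - \<nu> h p = \<nu> (g \<otimes> inv h) p" for p
      proof (cases p)
        case (Pair a b)
        show ?thesis
        proof (cases "b < n")
          case True
          have "real_of_int (\<nu> g (a, b) - \<nu> h (a, b)) = real_of_int (\<nu> (g \<otimes> inv h) (a, b))"
            using gh True radical_kernel_diff[of g h b a]
            by (simp add: of_\<nu> K_carrier) (simp add: K_def)
          then show ?thesis using Pair by (simp only: of_int_eq_iff)
        next
          case False
          then show ?thesis using Pair by (simp add: \<nu>_def)
        qed
      qed
      ultimately show ?thesis using gh by auto
    qed
  next
    fix q :: nat assume "q \<ge> 2"
    then obtain h where h: "h \<in> K" and fh: "f \<otimes> h \<in> principal_congruence_subgroup W n m w q"
      using contr avoids unfolding K_def by blast
    have hW: "h \<in> carrier W" using K_carrier[OF h] .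
    have "int q dvd \<nu> (inv f) (a, b) - \<nu> h (a, b)" if ab: "a < n" "b < n" for a b
    proof -
      have "\<exists>z. act (f \<otimes> h) (unit b) c - unit b c = real q * of_int z" if "c < n" for c
        using principal_congruence_act[OF fh that ab(2)] by (metis add_diff_cancel_left')
      then obtain z where z: "\<And>c. c < n \<Longrightarrow> act (f \<otimes> h) (unit b) c - unit b c = real q * of_int (z c)"
        by metis
      have "inv f \<otimes> (f \<otimes> h) = h" using f hW by (simp flip: m_assoc)
      then have "act h (unit b) = act (inv f) (act (f \<otimes> h) (unit b))"
        using act_mult[of "inv f" "f \<otimes> h" "unit b"] f hW by simp
      \<comment> \<open>Multiplying \<open>f h - 1\<close>, which is divisible by \<open>q\<close>,
        by the integral matrix of \<open>inv f\<close> shows that \<open>h - inv f\<close> is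
        divisible by \<open>q\<close>.\<close>
      then have "act h (unit b) a - act (inv f) (unit b) a
          = act (inv f) (\<lambda>c. act (f \<otimes> h) (unit b) c - 1 * unit b c) a"
        using f by (simp only: act_diff inv_closed)
      also have "\<dots> = (\<Sum>c<n. act (inv f) (unit c) a * (real q * of_int (z c)))"
        using f ab z by (subst act_expand) simp_all
      also have "\<dots> = real q * (\<Sum>c<n. of_int \<lfloor>act (inv f) (unit c) a\<rfloor> * of_int (z c))"
        using act_integral[of "inv f" _ a] f by (simp add: sum_distrib_left algebra_simps)
      finally have "real_of_int (\<nu> h (a, b) - \<nu> (inv f) (a, b))
          = of_int (int q * (\<Sum>c<n. \<lfloor>act (inv f) (unit c) a\<rfloor> * z c))"
        using f hW ab by (simp add: of_\<nu>)
      then have "int q dvd \<nu> h (a, b) - \<nu> (inv f) (a, b)"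
        by (simp only: of_int_eq_iff dvd_triv_left)
      then show ?thesis by (simp add: dvd_diff_commute)
    qed
    then show "\<exists>l\<in>\<nu> ` K. \<forall>p\<in>I. int q dvd \<nu> (inv f) p - l p"
      using h by (auto simp: I_def)
  qed
  then obtain h where h: "h \<in> K" and eq: "\<And>a b. a < n \<Longrightarrow> b < n \<Longrightarrow> \<nu> (inv f) (a, b) = \<nu> h (a, b)"
    by (auto simp: I_def)
  have hW: "h \<in> carrier W" using K_carrier[OF h] .
  have "act (inv f) (unit b) = act h (unit b)" if b: "b < n" for b
  proof
    fix a
    show "act (inv f) (unit b) a = act h (unit b) a"
    proof (cases "a < n")
      case True
      then show ?thesis using of_\<nu>[of "inv f" b a] of_\<nu>[of h b a] eq[OF True b] b f hW by simp
    next
      case False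
      then show ?thesis using act_support f hW by simp
    qed
  qed
  then have "act (f \<otimes> h) (unit b) = unit b" if "b < n" for b
    using that f hW by (simp add: act_mult flip: \<open>\<And>b. b < n \<Longrightarrow> act (inv f) (unit b) = act h (unit b)\<close>)
  then have "f \<otimes> h = \<one>"
    using act_faithful[of "f \<otimes> h"] f hW by simp
  then have "f = inv h" using f hW by (metis inv_equality inv_inv)
  moreover have "inv h \<in> H" using h by (simp add: K_def)
  ultimately show False using f by simp
qed

lemma congruence_subgroup_property:
  assumes va: "virtually_abelian W"
  shows "has_congruence_subgroup_property W n m w"
  unfolding has_congruence_subgroup_property_def
proof (intro allI impI)
  fix H assume "finite_index_subgroup H W"
  then have H: "subgroup H W" and fin: "finite (rcosets H)"
    by (auto simp: finite_index_subgroup_def)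
  interpret H: subgroup H W by (rule H)
  \<comment> \<open>The right coset of \<open>inv g\<close> encodes the left coset of
    \<open>g\<close>. Equal values of \<open>\<Phi>\<close> thus mean the same left coset of
    \<open>H \<inter> radical_kernel\<close>, and \<open>F\<close> represents all of these.\<close>
  define \<Phi> where "\<Phi> g = (H #> inv g, gram_data g)" for g
  have "\<Phi> ` carrier W \<subseteq> (rcosets H) \<times> gram_data ` carrier W"
    by (auto simp: \<Phi>_def intro: rcosetsI[OF H.subset])
  then have "finite (\<Phi> ` carrier W)"
    using fin finite_range_gram_data[OF va] finite_subset by blast
  then obtain F where F: "F \<subseteq> carrier W" "finite F" "\<Phi> ` carrier W = \<Phi> ` F"
    using finite_subset_image[of "\<Phi> ` carrier W" \<Phi> "carrier W"] by auto
  have "\<exists>q\<ge>2. f \<notin> H \<longrightarrow>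
      (\<forall>h\<in>H \<inter> radical_kernel. f \<otimes> h \<notin> principal_congruence_subgroup W n m w q)"
    if "f \<in> F" for f
  proof (cases "f \<in> H")
    case True
    then show ?thesis by (intro exI[of _ 2]) simp
  next
    case False
    with coset_avoids_principal_congruence[OF H] F(1) that show ?thesis by (metis subsetD)
  qed
  then obtain q where q: "\<And>f. f \<in> F \<Longrightarrow> q f \<ge> 2"
    "\<And>f h. f \<in> F \<Longrightarrow> f \<notin> H \<Longrightarrow> h \<in> H \<inter> radical_kernel \<Longrightarrow>
      f \<otimes> h \<notin> principal_congruence_subgroup W n m w (q f)"
    by metis
  \<comment> \<open>The factor 2 gives \<open>Q \<ge> 2\<close> even for an empty product.\<close>
  define Q where "Q = 2 * (\<Prod>f\<in>F. q f)"
  have "(\<Prod>f\<in>F. q f) \<ge> 1"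
    using q(1) by (intro prod_ge_1) fastforce
  then have "Q \<ge> 2" by (simp add: Q_def)
  moreover have "principal_congruence_subgroup W n m w Q \<subseteq> H"
  proof
    fix g assume gQ: "g \<in> principal_congruence_subgroup W n m w Q"
    then have g: "g \<in> carrier W" by (simp add: principal_congruence_subgroup_def)
    then obtain f where f: "f \<in> F" and eq: "\<Phi> g = \<Phi> f" using F(3) by blast
    have fW: "f \<in> carrier W" using f F(1) by blast
    define h where "h = inv f \<otimes> g"
    have "h \<in> radical_kernel"
      using radical_kernel_of_gram_data[OF fW g] eq by (simp add: \<Phi>_def h_def)
    moreover have "h \<in> H"
    proof -
      have "H #> inv f = H #> inv g" using eq by (simp add: \<Phi>_def)
      then have "inv f \<in> H #> inv g" using rcos_self[OF _ H, of "inv f"] fW by simp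
      then obtain k where "k \<in> H" "inv f = k \<otimes> inv g" by (auto simp: r_coset_def)
      then have "h = k" using g by (simp add: h_def m_assoc)
      then show ?thesis using \<open>k \<in> H\<close> by simp
    qed
    ultimately have h: "h \<in> H \<inter> radical_kernel" by simp
    have g_eq: "g = f \<otimes> h" using g fW by (simp add: h_def flip: m_assoc)
    have "q f dvd Q" unfolding Q_def using f F(2) by (simp add: dvd_prodI)
    then have "g \<in> principal_congruence_subgroup W n m w (q f)"
      using gQ principal_congruence_antimono by blast
    then have "f \<in> H" using q(2)[OF f _ h] g_eq by blast
    then show "g \<in> H" using g_eq h by simp
  qed
  ultimately show "\<exists>q\<ge>2. principal_congruence_subgroup W n m w q \<subseteq> H" by blast
qed

end

theorem theorem4p11:
  fixes W :: "('a, 'b) monoid_scheme"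
    and n :: nat
    and m :: "nat \<Rightarrow> nat \<Rightarrow> enat"
    and w :: "nat \<Rightarrow> 'a"
  assumes "small_coxeter_system W n m w"
    and "infinite (carrier W)"
    and "virtually_abelian W"
  shows "has_congruence_subgroup_property W n m w"
proof -
  interpret small_coxeter W n m w
    using assms(1) by (rule small_coxeter.intro)
  show ?thesis using assms(3) by (rule congruence_subgroup_property)
qed

end
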